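(* Let $N=C_{(m,d_1)}$ and $T=C_{(k,d_2)}$ be bicyclic skew braces. Let $g=\gcd(m,k)$ and assume that $g=\gcd(d_1,d_2)$. Then $$M_b(N\times T)\simeq\mathbb{Z}/(d_1)\times\mathbb{Z}/(d_2)\times(\mathbb{Z}/(g))^3.$$
   Context: A skew brace is a triple $(A,+,\circ)$ where $(A,+)$ and $(A,\circ)$ are (not necessarily abelian) groups with $a\circ(b+c)=a\circ b-a+a\circ c$ for all $a,b,c\in A$. Both groups have the same neutral element $0$. Direct products of skew braces have componentwise operations. A skew brace is bicyclic if both its additive group $(A,+)$ and its multiplicative group $(A,\circ)$ are cyclic. For an integer $n\geq2$ and a divisor $d$ of $n$ such that every prime divisor of $n$ divides $d$, $C_{(n,d)}$ denotes the skew brace with underlying set $\mathbb{Z}/(n)$, usual addition, and $x\circ y=x+y+dxy$. For a skew brace $Q$ and a (multiplicative) abelian group $K$, a factor set is a pair $(\alpha,\mu)$ of maps $Q\times Q\to K$ such that for all $x,y,z\in Q$: $\alpha(0,y)=\alpha(x,0)=1$, $\mu(0,y)=\mu(x,0)=1$, $\alpha(y,z)\alpha(x+y,z)^{-1}\alpha(x,y+z)\alpha(x,y)^{-1}=1$, $\mu(y,z)\mu(x\circ y,z)^{-1}\mu(x,y\circ z)\mu(x,y)^{-1}=1$, and $\alpha(y,z)\mu(x,y+z)\alpha(-x,x)=\mu(x,z)\alpha(x\circ y,-x)\alpha(x\circ y-x,x\circ z)\mu(x,y)$. Factor sets form a group $Z^2_b(Q,K)$ under pointwise multiplication. For $h:Q\to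 K$ put $\partial_+h(x,y)=h(y)h(x+y)^{-1}h(x)$ and $\partial_\circ h(x,y)=h(y)h(x\circ y)^{-1}h(x)$. Let $B^2_b(Q,K)=\{(\partial_+h,\partial_\circ h): h:Q\to K,\ h(0)=1\}$ and $H^2_b(Q,K)=Z^2_b(Q,K)/B^2_b(Q,K)$. The Schur multiplier of a finite skew brace $Q$ is $M_b(Q)=H^2_b(Q,\mathbb{C}^\times)$. *)

theory Defs
  imports Complex_Main "HOL-Algebra.Algebra"
begin

text \<open>
  A skew brace is represented by the record type of HOL-Algebra's rings, which is used here only as
  a signature: \<open>\<oplus>\<close>, \<open>\<ominus>\<close>, \<open>\<zero>\<close> belong to the additive group, which need not be abelian, and \<open>\<otimes>\<close>, \<open>\<one>\<close>
  to the multiplicative group, so that \<open>x \<otimes> y\<close> stands for $x \circ y$.  With this encoding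
  \<^const>\<open>RDirProd\<close> is the direct product of skew braces.
\<close>

locale skew_brace =
  fixes A (structure)
  assumes add_group: "group (add_monoid A)"
    and circ_group: "group A"
    and brace: "\<lbrakk>a \<in> carrier A; b \<in> carrier A; c \<in> carrier A\<rbrakk>
      \<Longrightarrow> a \<otimes> (b \<oplus> c) = (a \<otimes> b \<ominus> a) \<oplus> (a \<otimes> c)"

lemma (in skew_brace) one_eq_zero: "\<one> = \<zero>"
proof -
  interpret add: group "add_monoid A" by (rule add_group)
  interpret circ: group A by (rule circ_group)
  have z: "\<zero> \<in> carrier A" using add.one_closed by simp
  have "\<one> \<otimes> (\<zero> \<oplus> \<zero>) = (\<one> \<otimes> \<zero> \<ominus> \<one>) \<oplus> (\<one> \<otimes> \<zero>)"
    by (rule brace) (auto simp: z)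
  then have "\<zero> = (\<zero> \<ominus> \<one>) \<oplus> \<zero>"
    using add.l_one[of \<zero>] z by simp
  then have "\<zero> = \<ominus> \<one>"
    using add.l_one add.r_one add.inv_closed[of \<one>] z by (simp add: a_minus_def a_inv_def)
  then show ?thesis
    using add.inv_inv[of \<one>] add.inv_one by (simp add: a_inv_def)
qed

definition bicyclic :: "('a, 'b) ring_scheme \<Rightarrow> bool"
  where "bicyclic A \<longleftrightarrow> skew_brace A \<and> cyclic_group (add_monoid A) \<and> cyclic_group A"

definition C_brace :: "nat \<Rightarrow> nat \<Rightarrow> int ring"
  where "C_brace n d =
    \<lparr>carrier = {0..<int n},
     monoid.mult = (\<lambda>x y. (x + y + int d * x * y) mod int n),
     one = 0,
     ring.zero = 0,
     ring.add = (\<lambda>x y. (x + y) mod int n)\<rparr>"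

text \<open>
  Maps $Q \times Q \to K$ are extensional functions on pairs, so that equality of factor sets is
  equality on the carrier.
\<close>

definition factor_sets ::
    "('a, 'b) ring_scheme \<Rightarrow> ('k, 'c) monoid_scheme \<Rightarrow> (('a \<times> 'a \<Rightarrow> 'k) \<times> ('a \<times> 'a \<Rightarrow> 'k)) set"
  where "factor_sets Q K = {(\<alpha>, \<mu>).
    \<alpha> \<in> carrier Q \<times> carrier Q \<rightarrow>\<^sub>E carrier K \<and>
    \<mu> \<in> carrier Q \<times> carrier Q \<rightarrow>\<^sub>E carrier K \<and>
    (\<forall>x\<in>carrier Q. \<alpha> (\<zero>\<^bsub>Q\<^esub>, x) = \<one>\<^bsub>K\<^esub> \<and> \<alpha> (x, \<zero>\<^bsub>Q\<^esub>) = \<one>\<^bsub>K\<^esub>) \<and>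
    (\<forall>x\<in>carrier Q. \<mu> (\<zero>\<^bsub>Q\<^esub>, x) = \<one>\<^bsub>K\<^esub> \<and> \<mu> (x, \<zero>\<^bsub>Q\<^esub>) = \<one>\<^bsub>K\<^esub>) \<and>
    (\<forall>x\<in>carrier Q. \<forall>y\<in>carrier Q. \<forall>z\<in>carrier Q.
       \<alpha> (y, z) \<otimes>\<^bsub>K\<^esub> inv\<^bsub>K\<^esub> \<alpha> (x \<oplus>\<^bsub>Q\<^esub> y, z) \<otimes>\<^bsub>K\<^esub> \<alpha> (x, y \<oplus>\<^bsub>Q\<^esub> z) \<otimes>\<^bsub>K\<^esub> inv\<^bsub>K\<^esub> \<alpha> (x, y) = \<one>\<^bsub>K\<^esub>) \<and>
    (\<forall>x\<in>carrier Q. \<forall>y\<in>carrier Q. \<forall>z\<in>carrier Q.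
       \<mu> (y, z) \<otimes>\<^bsub>K\<^esub> inv\<^bsub>K\<^esub> \<mu> (x \<otimes>\<^bsub>Q\<^esub> y, z) \<otimes>\<^bsub>K\<^esub> \<mu> (x, y \<otimes>\<^bsub>Q\<^esub> z) \<otimes>\<^bsub>K\<^esub> inv\<^bsub>K\<^esub> \<mu> (x, y) = \<one>\<^bsub>K\<^esub>) \<and>
    (\<forall>x\<in>carrier Q. \<forall>y\<in>carrier Q. \<forall>z\<in>carrier Q.
       \<alpha> (y, z) \<otimes>\<^bsub>K\<^esub> \<mu> (x, y \<oplus>\<^bsub>Q\<^esub> z) \<otimes>\<^bsub>K\<^esub> \<alpha> (\<ominus>\<^bsub>Q\<^esub> x, x) =
       \<mu> (x, z) \<otimes>\<^bsub>K\<^esub> \<alpha> (x \<otimes>\<^bsub>Q\<^esub> y, \<ominus>\<^bsub>Q\<^esub> x) \<otimes>\<^bsub>K\<^esub> \<alpha> (x \<otimes>\<^bsub>Q\<^esub> y \<ominus>\<^bsub>Q\<^esub> x, x \<otimes>\<^bsub>Q\<^esub> z) \<otimes>\<^bsub>K\<^esub> \<mu> (x, y))}"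

definition Z2b ::
    "('a, 'b) ring_scheme \<Rightarrow> ('k, 'c) monoid_scheme \<Rightarrow> (('a \<times> 'a \<Rightarrow> 'k) \<times> ('a \<times> 'a \<Rightarrow> 'k)) monoid"
  where "Z2b Q K =
    (product_group (carrier Q \<times> carrier Q) (\<lambda>_. K) \<times>\<times>
     product_group (carrier Q \<times> carrier Q) (\<lambda>_. K))\<lparr>carrier := factor_sets Q K\<rparr>"

text \<open>
  For \<open>G = add_monoid Q\<close> this is $\partial_+ h$, and for \<open>G = Q\<close> it is $\partial_\circ h$.
\<close>

definition coboundary ::
    "('a, 'b) monoid_scheme \<Rightarrow> ('k, 'c) monoid_scheme \<Rightarrow> ('a \<Rightarrow> 'k) \<Rightarrow> 'a \<times> 'a \<Rightarrow> 'k"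
  where "coboundary G K h =
    (\<lambda>(x, y)\<in>carrier G \<times> carrier G. h y \<otimes>\<^bsub>K\<^esub> inv\<^bsub>K\<^esub> h (x \<otimes>\<^bsub>G\<^esub> y) \<otimes>\<^bsub>K\<^esub> h x)"

definition B2b ::
    "('a, 'b) ring_scheme \<Rightarrow> ('k, 'c) monoid_scheme \<Rightarrow> (('a \<times> 'a \<Rightarrow> 'k) \<times> ('a \<times> 'a \<Rightarrow> 'k)) set"
  where "B2b Q K =
    {(coboundary (add_monoid Q) K h, coboundary Q K h) | h.
       h \<in> carrier Q \<rightarrow> carrier K \<and> h \<zero>\<^bsub>Q\<^esub> = \<one>\<^bsub>K\<^esub>}"

definition H2b ::
    "('a, 'b) ring_scheme \<Rightarrow> ('k, 'c) monoid_scheme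
      \<Rightarrow> (('a \<times> 'a \<Rightarrow> 'k) \<times> ('a \<times> 'a \<Rightarrow> 'k)) set monoid"
  where "H2b Q K = Z2b Q K Mod B2b Q K"

definition complex_units :: "complex monoid"
  where "complex_units = \<lparr>carrier = UNIV - {0}, monoid.mult = (*), one = 1\<rparr>"

lemma comm_group_complex_units: "comm_group complex_units"
  by (rule comm_groupI) (auto simp: complex_units_def intro!: bexI[of _ "inverse _"])

definition schur_multiplier ::
    "('a, 'b) ring_scheme \<Rightarrow> (('a \<times> 'a \<Rightarrow> complex) \<times> ('a \<times> 'a \<Rightarrow> complex)) set monoid"
  where "schur_multiplier Q = H2b Q complex_units"

end

theory Submission
  imports Defs "HOL-Number_Theory.Cong" "HOL-Computational_Algebra.Fundamental_Theorem_Algebra"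
begin

text \<open>
  Let $\alpha$ be the additive part of a factor set of $N \times T$.  In the central extension of
  $\mathbb{Z}/(m) \times \mathbb{Z}/(k)$ by $\mathbb{C}^\times$ that $\alpha$ defines, lift the two
  generators to elements $U$, $V$ with $U^m = V^k = 1$; their commutator is a central $g$-th root of
  unity, and comparing with the section $x \mapsto V^{x_2} U^{x_1}$ makes $\alpha$ cohomologous to
  $\zeta^{r x_1 y_2}$, $\zeta = e^{2 \pi i / g}$.  As $g$ divides $d_1$ and $d_2$, such an $\alpha$
  drops out of the compatibility condition, which then says that $\mu(x, -)$ is an additive
  character; the cocycle condition makes $x \mapsto \mu(x, -)$ a crossed homomorphism from the
  multiplicative group to the character group.  The component with values in the characters of $N$
  has the form $x \mapsto a x_1 + (m/g) s x_2$ modulo $m$, because the multiplicative groups of $N$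
  and $T$ are cyclic, and symmetrically for $T$.  Thus every factor set is cohomologous to one given
  by five integers $(a, b, r, s, t)$, and this one is a coboundary iff
  $d_1 \mid a$, $d_2 \mid b$ and $g$ divides $r$, $s$, $t$.
\<close>

text \<open>The moduli d_1, d_2 have their origin in the coboundaries. If the additive coboundary of
  h is trivial, then h is a character of Z/(m) x Z/(k). For h(x) = e^(-2 pi i a' x_1 / m) the
  multiplicative coboundary is e^(2 pi i d_1 a' x_1 y_1 / m), because circ differs from + by d_1 x_1
  y_1 in the first coordinate. Characters therefore change a only by multiples of d_1, likewise b
  only by multiples of d_2, and never touch s or t, since circ on the product has no mixed terms.
  The coefficient m/g has its origin in the commutation of N and T. If v generates the
  multiplicative group of T, then the value of the crossed homomorphism at (0, v) is killed modulo m
  by d_1, as (0, v) commutes with (1, 0), and by k, as v has k-th power 0. Hence gcd(d_1, k) kills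
  it, and this divides g because d_1 divides m. Conversely, g dividing both d_1 and d_2 is what
  makes every multiple of m/g admissible.\<close>

lemma iso_if_surj_same_kernel:
  assumes "group_hom G H f" and "group_hom G H' f'"
    and "f ` carrier G = carrier H" and "f' ` carrier G = carrier H'"
    and "kernel G H f = kernel G H' f'"
  shows "H \<cong> H'"
proof -
  have "G Mod kernel G H f \<cong> H" "G Mod kernel G H f \<cong> H'"
    using group_hom.FactGroup_iso[OF assms(1)] group_hom.FactGroup_iso[OF assms(2)] assms by auto
  moreover have "group (G Mod kernel G H f)"
    using normal.factorgroup_is_group[OF group_hom.normal_kernel[OF assms(1)]] .
  ultimately show ?thesis
    using group.iso_sym iso_trans by blast
qed

section \<open>Roots of unity\<close>

text \<open>The exponent is an unreduced integer, so that identities between roots become polynomial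
  identities of exponents, with negative ones allowed, and reductions in the carriers become
  congruences.\<close>

definition root_of_unity :: "nat \<Rightarrow> int \<Rightarrow> complex"
  where "root_of_unity n t = cis (2 * pi * of_int t / of_nat n)"

lemma root_of_unity_nonzero [simp]: "root_of_unity n t \<noteq> 0"
  by (simp add: root_of_unity_def)

lemma root_of_unity_0 [simp]: "root_of_unity n 0 = 1"
  by (simp add: root_of_unity_def)

lemma root_of_unity_add: "root_of_unity n (s + t) = root_of_unity n s * root_of_unity n t"
  by (simp add: root_of_unity_def cis_mult add_divide_distrib distrib_left)

lemma root_of_unity_power: "root_of_unity n t ^ j = root_of_unity n (int j * t)"
  by (simp add: root_of_unity_def DeMoivre algebra_simps)

lemma root_of_unity_eq_1_iff:
  assumes "n > 0"
  shows "root_of_unity n t = 1 \<longleftrightarrow> int n dvd t"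
proof
  assume "root_of_unity n t = 1"
  then have "cos (2 * pi * of_int t / of_nat n) = 1"
    by (metis root_of_unity_def cis.sel(1) one_complex.sel(1))
  then obtain j :: int where "2 * pi * of_int t / of_nat n = of_int j * 2 * pi"
    by (auto simp: cos_one_2pi_int)
  then have "real_of_int t = of_int (j * int n)"
    using assms by (simp add: field_simps)
  then show "int n dvd t"
    by (metis of_int_eq_iff dvd_triv_right)
next
  assume "int n dvd t"
  then obtain j where "t = int n * j" ..
  moreover have "cis (2 * pi * of_int j) = 1"
    by (rule cis_multiple_2pi) simp
  ultimately show "root_of_unity n t = 1"
    using assms by (simp add: root_of_unity_def mult.assoc)
qed

lemma root_of_unity_cong_iff:
  assumes "n > 0"
  shows "root_of_unity n s = root_of_unity n t \<longleftrightarrow> [s = t] (mod int n)"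
proof -
  have "root_of_unity n s = root_of_unity n (s - t) * root_of_unity n t"
    by (simp flip: root_of_unity_add)
  then show ?thesis
    using root_of_unity_eq_1_iff[OF assms, of "s - t"] by (auto simp: cong_iff_dvd_diff)
qed

lemma root_of_unity_cong_mult:
  assumes "[x = x'] (mod int n)" and "[y = y'] (mod int n)" and "n > 0"
  shows "root_of_unity n (c * x * y) = root_of_unity n (c * x' * y')"
  using assms by (simp add: root_of_unity_cong_iff cong_mult)

lemma root_of_unity_add_right:
  assumes "[q = p + p'] (mod int n)" and "n > 0"
  shows "root_of_unity n (c * x * q) = root_of_unity n (c * x * p) * root_of_unity n (c * x * p')"
proof -
  have "root_of_unity n (c * x * q) = root_of_unity n (c * x * (p + p'))"
    using assms by (simp add: root_of_unity_cong_iff cong_mult)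
  then show ?thesis by (simp add: distrib_left root_of_unity_add)
qed

lemma root_of_unity_add_left:
  assumes "[q = p + p'] (mod int n)" and "n > 0"
  shows "root_of_unity n (c * q * x) = root_of_unity n (c * p * x) * root_of_unity n (c * p' * x)"
  using root_of_unity_add_right[OF assms, of c x] by (simp add: ac_simps)

text \<open>Both exponents expand to \<open>a\<close> times the symmetric polynomial xy + yz + xz +
  cxyz.\<close>

lemma root_of_unity_circ_cocycle:
  assumes "[q = x + y + c * x * y] (mod int n)" and "[q' = y + z + c * y * z] (mod int n)" and "n > 0"
  shows "root_of_unity n (a * y * z) * root_of_unity n (a * x * q') =
    root_of_unity n (a * q * z) * root_of_unity n (a * x * y)"
proof -
  have "root_of_unity n (a * x * q') = root_of_unity n (a * x * (y + z + c * y * z))"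
    and "root_of_unity n (a * q * z) = root_of_unity n (a * (x + y + c * x * y) * z)"
    using assms by (auto intro!: cong_mult simp: root_of_unity_cong_iff)
  then show ?thesis
    by (simp add: algebra_simps flip: root_of_unity_add)
qed

lemma obtain_root_of_unity:
  assumes "n > 0" and "z ^ n = 1"
  obtains t where "z = root_of_unity n t"
proof -
  have "z \<in> (\<lambda>j. cis (2 * pi * real j / real n)) ` {..<n}"
    using bij_betw_roots_unity[OF assms(1)] assms(2) by (auto simp: bij_betw_def)
  then obtain j where "z = cis (2 * pi * real j / real n)" by blast
  then have "z = root_of_unity n (int j)" by (simp add: root_of_unity_def)
  then show thesis ..
qed

lemma power_mod_exponent:
  fixes z :: "'a :: monoid_mult"
  assumes "z ^ n = 1"
  shows "z ^ (j mod n) = z ^ j"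
proof -
  have "z ^ j = z ^ (n * (j div n)) * z ^ (j mod n)"
    by (simp flip: power_add)
  then show ?thesis using assms by (simp add: power_mult)
qed

text \<open>Euclid's algorithm: an exponent may be reduced modulo any exponent that kills
  \<open>z\<close>.\<close>

lemma power_gcd_eq_1:
  fixes z :: "'a :: field"
  assumes "z ^ m = 1" and "z ^ k = 1"
  shows "z ^ gcd m k = 1"
  using assms
proof (induction m k rule: gcd_nat_induct)
  case (step m n)
  then show ?case by (simp add: power_mod_exponent gcd_red_nat[of m n])
qed simp

text \<open>Meant for an additive character \<open>f\<close> whose multiplicative coboundary is e^(2
  pi i a x y / n); the last hypothesis is its value at (1, 1), where 1 circ 1 = 2 + d. It says that
  the root with exponent \<open>a\<close> is the inverse of f(1)^d. Since f(1)^n = 1, raising to the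
  power n/d leaves n | (n/d) a.\<close>

lemma dvd_if_character:
  assumes "n > 1" and "d dvd n"
    and add: "\<And>i j. \<lbrakk>i \<in> {0..<int n}; j \<in> {0..<int n}\<rbrakk> \<Longrightarrow> f ((i + j) mod int n) = f i * f j"
    and nonzero: "\<And>i. i \<in> {0..<int n} \<Longrightarrow> f i \<noteq> 0"
    and a: "root_of_unity n a = f 1 * f 1 / f ((2 + int d) mod int n)"
  shows "int d dvd a"
proof -
  have f_pow: "f (int i mod int n) = f 1 ^ i" for i
  proof (induction i)
    case 0
    show ?case using add[of 0 0] nonzero[of 0] assms(1) by simp
  next
    case (Suc i)
    then show ?case
      using add[of "int i mod int n" 1] assms(1) by (simp add: mod_simps add.commute)
  qed
  define q where "q = n div d"
  have n: "n = d * q" using assms(2) by (simp add: q_def)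
  have "f 1 \<noteq> 0" using nonzero assms(1) by simp
  have "f 1 ^ n = 1" using f_pow[of n] f_pow[of 0] by simp
  have "root_of_unity n a * f 1 ^ d = 1"
    using a f_pow[of "2 + d"] \<open>f 1 \<noteq> 0\<close> by (simp add: power_add power2_eq_square)
  then have "(root_of_unity n a * f 1 ^ d) ^ q = 1" by simp
  then have "root_of_unity n (int q * a) = 1"
    using \<open>f 1 ^ n = 1\<close> by (simp add: power_mult_distrib root_of_unity_power n flip: power_mult)
  then have "int n dvd int q * a"
    using assms(1) by (simp add: root_of_unity_eq_1_iff)
  then have "int q * int d dvd int q * a"
    by (simp add: n mult.commute)
  then show ?thesis using assms(1) n by auto
qed

section \<open>Central extensions and bilinear cocycles\<close>

lemma (in group) pow_mod_exponent:
  assumes "x \<in> carrier G" and "x [^] n = \<one>"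
  shows "x [^] (j mod n) = x [^] (j :: nat)"
proof -
  have "x [^] j = x [^] (n * (j div n)) \<otimes> x [^] (j mod n)"
    using assms by (simp add: nat_pow_mult)
  also have "x [^] (n * (j div n)) = \<one>"
    using assms by (simp flip: nat_pow_pow)
  finally show ?thesis using assms by simp
qed

text \<open>Moving one \<open>u\<close> past one \<open>v\<close> costs one \<open>z\<close>, and
  central factors can be collected in front; i * j such moves are made.\<close>

lemma (in group) central_commutator_pow:
  fixes i j :: nat
  assumes [simp]: "u \<in> carrier G" "v \<in> carrier G" "z \<in> carrier G"
    and central: "\<And>x. x \<in> carrier G \<Longrightarrow> z \<otimes> x = x \<otimes> z"
    and uv: "u \<otimes> v = z \<otimes> (v \<otimes> u)"
  shows "u [^] i \<otimes> v [^] j = z [^] (i * j) \<otimes> (v [^] j \<otimes> u [^] i)"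
proof -
  have zc: "x \<otimes> (z [^] n \<otimes> y) = z [^] n \<otimes> (x \<otimes> y)"
    if "x \<in> carrier G" "y \<in> carrier G" for x y and n :: nat
    using that group_commutes_pow[OF central[OF that(1)], of n] by (simp flip: m_assoc)
  have one: "u \<otimes> v [^] j = z [^] j \<otimes> (v [^] j \<otimes> u)"
  proof (induction j)
    case (Suc j)
    have "u \<otimes> v [^] Suc j = (u \<otimes> v [^] j) \<otimes> v" by (simp add: m_assoc)
    also have "\<dots> = z [^] j \<otimes> (v [^] j \<otimes> (u \<otimes> v))" by (simp add: Suc m_assoc)
    also have "\<dots> = z [^] j \<otimes> (z \<otimes> (v [^] j \<otimes> (v \<otimes> u)))"
      using zc[of "v [^] j" "v \<otimes> u" 1] by (simp add: uv)
    finally show ?case by (simp add: m_assoc)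
  qed simp
  show ?thesis
  proof (induction i)
    case (Suc i)
    have "u [^] Suc i \<otimes> v [^] j = u [^] i \<otimes> (u \<otimes> v [^] j)" by (simp add: m_assoc)
    also have "\<dots> = z [^] j \<otimes> (u [^] i \<otimes> v [^] j \<otimes> u)"
      by (simp add: one zc m_assoc)
    also have "\<dots> = z [^] (j + i * j) \<otimes> (v [^] j \<otimes> u [^] i \<otimes> u)"
      by (simp add: Suc m_assoc flip: nat_pow_mult)
    finally show ?case by (simp add: m_assoc)
  qed simp
qed

text \<open>For a normalized cocycle, the section x |-> (1, x) has \<open>\<alpha>\<close> as its
  factor set. A section x |-> (c x, x) has the factor set c(x) c(y) \<alpha>(x, y) / c(xy), so the
  choice of another section amounts to the choice of a cohomologous cocycle.\<close>

definition central_extension :: "('a, 'b) monoid_scheme \<Rightarrow> ('a \<times> 'a \<Rightarrow> complex) \<Rightarrow> (complex \<times> 'a) monoid"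
  where "central_extension G \<alpha> =
    \<lparr>carrier = (UNIV - {0}) \<times> carrier G,
     monoid.mult = (\<lambda>(a, x) (b, y). (a * b * \<alpha> (x, y), x \<otimes>\<^bsub>G\<^esub> y)),
     one = (1, \<one>\<^bsub>G\<^esub>)\<rparr>"

lemma central_extension_simps [simp]:
  "carrier (central_extension G \<alpha>) = (UNIV - {0}) \<times> carrier G"
  "(a, x) \<otimes>\<^bsub>central_extension G \<alpha>\<^esub> (b, y) = (a * b * \<alpha> (x, y), x \<otimes>\<^bsub>G\<^esub> y)"
  "\<one>\<^bsub>central_extension G \<alpha>\<^esub> = (1, \<one>\<^bsub>G\<^esub>)"
  by (simp_all add: central_extension_def)

locale complex_cocycle = group +
  fixes \<alpha> :: "'a \<times> 'a \<Rightarrow> complex"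
  assumes nonzero: "\<lbrakk>x \<in> carrier G; y \<in> carrier G\<rbrakk> \<Longrightarrow> \<alpha> (x, y) \<noteq> 0"
    and normalized: "x \<in> carrier G \<Longrightarrow> \<alpha> (\<one>, x) = 1" "x \<in> carrier G \<Longrightarrow> \<alpha> (x, \<one>) = 1"
    and cocycle: "\<lbrakk>x \<in> carrier G; y \<in> carrier G; z \<in> carrier G\<rbrakk>
      \<Longrightarrow> \<alpha> (y, z) * \<alpha> (x, y \<otimes> z) = \<alpha> (x \<otimes> y, z) * \<alpha> (x, y)"
begin

abbreviation "E \<equiv> central_extension G \<alpha>"

lemma group_central_extension: "group E"
proof (rule groupI)
  fix p q r assume "p \<in> carrier E" "q \<in> carrier E" "r \<in> carrier E"
  then show "p \<otimes>\<^bsub>E\<^esub> q \<otimes>\<^bsub>E\<^esub> r = p \<otimes>\<^bsub>E\<^esub> (q \<otimes>\<^bsub>E\<^esub> r)"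
    using cocycle by (auto simp: m_assoc mult.assoc mult.left_commute)
next
  fix p assume "p \<in> carrier E"
  then obtain a x where "p = (a, x)" "a \<noteq> 0" "x \<in> carrier G" by auto
  then show "\<exists>q\<in>carrier E. q \<otimes>\<^bsub>E\<^esub> p = \<one>\<^bsub>E\<^esub>"
    using nonzero by (intro bexI[of _ "(1 / (a * \<alpha> (inv x, x)), inv x)"]) auto
qed (auto simp: nonzero normalized)

lemma snd_pow:
  assumes "p \<in> carrier E"
  shows "snd (p [^]\<^bsub>E\<^esub> (n :: nat)) = snd p [^] n"
proof -
  interpret E: group E by (rule group_central_extension)
  show ?thesis
  proof (induction n)
    case (Suc n)
    obtain a x b y where "p = (a, x)" "p [^]\<^bsub>E\<^esub> n = (b, y)" by force
    then show ?case using Suc by simp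
  qed simp
qed

lemma central_pow: "a \<noteq> 0 \<Longrightarrow> (a, \<one>) [^]\<^bsub>E\<^esub> (n :: nat) = (a ^ n, \<one>)"
  by (induction n) (simp_all add: normalized group.is_monoid[OF group_central_extension] monoid.nat_pow_0 monoid.nat_pow_Suc)

text \<open>Rescaling a lift is possible because every complex number has an \<open>n\<close>-th root.\<close>

lemma obtain_torsion_lift:
  assumes "x \<in> carrier G" and "x [^] (n :: nat) = \<one>" and "n > 0"
  obtains a where "a \<noteq> 0" and "(a, x) [^]\<^bsub>E\<^esub> n = \<one>\<^bsub>E\<^esub>"
proof -
  interpret E: group E by (rule group_central_extension)
  have c: "(1, x) \<in> carrier E" using assms by simp
  obtain w where w: "(1, x) [^]\<^bsub>E\<^esub> n = (w, \<one>)"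
    using snd_pow[OF c, of n] assms by (metis prod.collapse snd_conv)
  have "w \<noteq> 0" using E.nat_pow_closed[OF c, of n] w by auto
  obtain a where a: "a ^ n = inverse w"
    using nth_root_exists[OF assms(3)] by blast
  then have "a \<noteq> 0" using \<open>w \<noteq> 0\<close> assms(3) by (auto simp: power_0_left)
  have "(a, x) = (a, \<one>) \<otimes>\<^bsub>E\<^esub> (1, x)" using assms by (simp add: normalized)
  moreover have "(a, \<one>) \<otimes>\<^bsub>E\<^esub> (1, x) = (1, x) \<otimes>\<^bsub>E\<^esub> (a, \<one>)"
    using assms by (simp add: normalized)
  ultimately have "(a, x) [^]\<^bsub>E\<^esub> n = (a, \<one>) [^]\<^bsub>E\<^esub> n \<otimes>\<^bsub>E\<^esub> (1, x) [^]\<^bsub>E\<^esub> n"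
    using E.pow_mult_distrib[of "(a, \<one>)" "(1, x)" n] c \<open>a \<noteq> 0\<close> by simp
  also have "\<dots> = \<one>\<^bsub>E\<^esub>"
    using \<open>a \<noteq> 0\<close> \<open>w \<noteq> 0\<close> by (simp add: w a central_pow normalized)
  finally show thesis using that \<open>a \<noteq> 0\<close> by blast
qed

end

lemma integer_mod_group_pow:
  assumes "n > 1"
  shows "1 [^]\<^bsub>integer_mod_group n\<^esub> (j :: nat) = int j mod int n"
  using assms
  by (induction j)
    (simp_all add: group.is_monoid[OF group_integer_mod_group] monoid.nat_pow_0 monoid.nat_pow_Suc
       mod_simps add.commute)

lemma DirProd_pow:
  assumes "group G" and "group H"
  shows "(x, y) [^]\<^bsub>G \<times>\<times> H\<^esub> (j :: nat) = (x [^]\<^bsub>G\<^esub> j, y [^]\<^bsub>H\<^esub> j)"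
  using assms
  by (induction j) (simp_all add: DirProd_group monoid.nat_pow_0 monoid.nat_pow_Suc group.is_monoid)

text \<open>The function \<open>c\<close> is the scalar coordinate of a new section built from
  powers of two torsion lifts. Torsion means that reducing exponents modulo m and k produces no
  carry, so the commutator is the only thing left in the factor set of that section.\<close>

lemma bilinear_representative:
  fixes m k :: nat
  defines "A \<equiv> integer_mod_group m \<times>\<times> integer_mod_group k"
  assumes "complex_cocycle A \<alpha>" and "m > 1" and "k > 1"
  obtains \<zeta> c where "\<zeta> ^ m = 1" and "\<zeta> ^ k = 1"
    and "c (0, 0) = 1" and "\<And>x. x \<in> carrier A \<Longrightarrow> c x \<noteq> 0"
    and "\<And>x y. \<lbrakk>x \<in> carrier A; y \<in> carrier A\<rbrakk>
      \<Longrightarrow> c x * c y * \<alpha> (x, y) = \<zeta> ^ (nat (fst x) * nat (snd y)) * c (x \<otimes>\<^bsub>A\<^esub> y)"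
proof -
  interpret A: complex_cocycle A \<alpha> by fact
  define E where "E = central_extension A \<alpha>"
  interpret E: group E unfolding E_def by (rule A.group_central_extension)
  have carrier_A: "carrier A = {0..<int m} \<times> {0..<int k}"
    using assms by (simp add: A_def carrier_integer_mod_group)
  have one_A: "\<one>\<^bsub>A\<^esub> = (0, 0)" by (simp add: A_def)
  have mult_A: "x \<otimes>\<^bsub>A\<^esub> y = ((fst x + fst y) mod int m, (snd x + snd y) mod int k)" for x y
    by (cases x; cases y) (simp add: A_def)
  have zero_pow: "0 [^]\<^bsub>integer_mod_group n\<^esub> (j :: nat) = 0" for n j
    using monoid.nat_pow_one[OF group.is_monoid[OF group_integer_mod_group], of n j] by simp
  have pow_u: "(1, 0) [^]\<^bsub>A\<^esub> j = (int j mod int m, 0)"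
    and pow_v: "(0, 1) [^]\<^bsub>A\<^esub> j = (0, int j mod int k)" for j
    using assms(3,4) by (simp_all add: A_def DirProd_pow integer_mod_group_pow zero_pow)
  have "(1, 0) \<in> carrier A" "(1, 0) [^]\<^bsub>A\<^esub> m = \<one>\<^bsub>A\<^esub>" "m > 0"
    using assms(3,4) by (auto simp: carrier_A one_A pow_u)
  then obtain a where a: "a \<noteq> 0" "(a, (1, 0)) [^]\<^bsub>E\<^esub> m = \<one>\<^bsub>E\<^esub>"
    unfolding E_def by (rule A.obtain_torsion_lift)
  have "(0, 1) \<in> carrier A" "(0, 1) [^]\<^bsub>A\<^esub> k = \<one>\<^bsub>A\<^esub>" "k > 0"
    using assms(3,4) by (auto simp: carrier_A one_A pow_v)
  then obtain b where b: "b \<noteq> 0" "(b, (0, 1)) [^]\<^bsub>E\<^esub> k = \<one>\<^bsub>E\<^esub>"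
    unfolding E_def by (rule A.obtain_torsion_lift)
  define u v where "u = (a, (1 :: int, 0 :: int))" and "v = (b, (0 :: int, 1 :: int))"
  have uv [simp]: "u \<in> carrier E" "v \<in> carrier E"
    using a(1) b(1) assms(3,4) by (auto simp: u_def v_def E_def carrier_A)
  have um: "u [^]\<^bsub>E\<^esub> m = \<one>\<^bsub>E\<^esub>" and vk: "v [^]\<^bsub>E\<^esub> k = \<one>\<^bsub>E\<^esub>"
    using a b by (auto simp: u_def v_def)
  \<comment> \<open>Both products of \<open>u\<close> and \<open>v\<close> lie over (1, 1), with
    scalar a * b times one of these two values; the quotient is the scalar of the
    commutator.\<close>
  define \<zeta> where "\<zeta> = \<alpha> ((1, 0), (0, 1)) / \<alpha> ((0, 1), (1, 0))"
  define z where "z = (\<zeta>, (0 :: int, 0 :: int))"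
  have "\<zeta> \<noteq> 0"
    using A.nonzero assms(3,4) by (simp add: \<zeta>_def carrier_A)
  then have z [simp]: "z \<in> carrier E"
    using assms(3,4) by (simp add: z_def E_def carrier_A)
  have scalar_mult: "(w, (0, 0)) \<otimes>\<^bsub>E\<^esub> p = (w * fst p, snd p)"
    and mult_scalar: "p \<otimes>\<^bsub>E\<^esub> (w, (0, 0)) = (w * fst p, snd p)" if "p \<in> carrier E" for w p
    using that A.normalized A.r_one A.l_one by (auto simp: E_def one_A[symmetric] simp del: A.r_one A.l_one)
  have z_pow: "z [^]\<^bsub>E\<^esub> j = (\<zeta> ^ j, (0, 0))" for j :: nat
    using A.central_pow[OF \<open>\<zeta> \<noteq> 0\<close>] by (simp add: z_def E_def one_A)
  have "u \<otimes>\<^bsub>E\<^esub> v = z \<otimes>\<^bsub>E\<^esub> (v \<otimes>\<^bsub>E\<^esub> u)"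
  proof -
    have "\<alpha> ((0, 1), (1, 0)) \<noteq> 0"
      using A.nonzero assms(3,4) by (simp add: carrier_A)
    moreover have "v \<otimes>\<^bsub>E\<^esub> u \<in> carrier E" by simp
    ultimately show ?thesis
      unfolding z_def by (subst scalar_mult) (simp_all add: u_def v_def E_def mult_A \<zeta>_def)
  qed
  then have comm: "u [^]\<^bsub>E\<^esub> i \<otimes>\<^bsub>E\<^esub> v [^]\<^bsub>E\<^esub> j
      = z [^]\<^bsub>E\<^esub> (i * j) \<otimes>\<^bsub>E\<^esub> (v [^]\<^bsub>E\<^esub> j \<otimes>\<^bsub>E\<^esub> u [^]\<^bsub>E\<^esub> i)" for i j :: nat
    using E.central_commutator_pow[OF uv z] scalar_mult mult_scalar by (simp add: z_def)
  have scalar_cancel: "w = 1" if "p = (w, (0, 0)) \<otimes>\<^bsub>E\<^esub> p" "p \<in> carrier E" for w p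
    using that scalar_mult[OF that(2), of w] by (cases p) (auto simp: E_def)
  \<comment> \<open>As \<open>u\<close> to the power m is neutral, it commutes with
    \<open>v\<close>, while the commutator formula charges \<zeta>^m for the exchange; similarly for
    \<open>v\<close> to the power k.\<close>
  have \<zeta>: "\<zeta> ^ m = 1" "\<zeta> ^ k = 1"
    using scalar_cancel[of v "\<zeta> ^ m"] scalar_cancel[of u "\<zeta> ^ k"] comm[of m 1] comm[of 1 k]
    by (simp_all add: um vk z_pow)
  \<comment> \<open>With the power of \<open>v\<close> on the left, multiplying two values of
    \<open>s\<close> only moves u^x1 past v^y2, whence the exponent x1 * y2.\<close>
  define s where "s x = v [^]\<^bsub>E\<^esub> nat (snd x) \<otimes>\<^bsub>E\<^esub> u [^]\<^bsub>E\<^esub> nat (fst x)" for x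
  have s_closed: "s x \<in> carrier E" for x by (simp add: s_def)
  have snd_mult: "snd (p \<otimes>\<^bsub>E\<^esub> q) = snd p \<otimes>\<^bsub>A\<^esub> snd q" for p q
    by (cases p; cases q) (simp add: E_def)
  have int_pair: "\<exists>x1 x2. x = (int x1, int x2)" if "x \<in> carrier A" for x
  proof -
    have "x = (int (nat (fst x)), int (nat (snd x)))"
      using that by (cases x) (auto simp: carrier_A)
    then show ?thesis by blast
  qed
  have snd_s: "snd (s x) = x" if "x \<in> carrier A" for x
  proof -
    obtain x1 x2 where x: "x = (int x1, int x2)"
      using int_pair[OF \<open>x \<in> carrier A\<close>] by blast
    have "snd (u [^]\<^bsub>E\<^esub> x1) = (int x1 mod int m, 0)" "snd (v [^]\<^bsub>E\<^esub> x2) = (0, int x2 mod int k)"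
      using A.snd_pow[of u x1] A.snd_pow[of v x2] uv
      by (auto simp: E_def[symmetric] u_def v_def pow_u pow_v)
    then show ?thesis
      using that by (simp add: s_def x snd_mult mult_A carrier_A)
  qed
  have s_mult: "s x \<otimes>\<^bsub>E\<^esub> s y = (\<zeta> ^ (nat (fst x) * nat (snd y)), (0, 0)) \<otimes>\<^bsub>E\<^esub> s (x \<otimes>\<^bsub>A\<^esub> y)"
    if "x \<in> carrier A" "y \<in> carrier A" for x y
  proof -
    obtain x1 x2 y1 y2 where xy: "x = (int x1, int x2)" "y = (int y1, int y2)"
      using int_pair \<open>x \<in> carrier A\<close> \<open>y \<in> carrier A\<close> by metis
    let ?u = "\<lambda>i :: nat. u [^]\<^bsub>E\<^esub> i" and ?v = "\<lambda>i :: nat. v [^]\<^bsub>E\<^esub> i"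
    let ?z = "z [^]\<^bsub>E\<^esub> (x1 * y2)"
    have zc: "p \<otimes>\<^bsub>E\<^esub> ?z = ?z \<otimes>\<^bsub>E\<^esub> p" if "p \<in> carrier E" for p
      using that by (simp add: z_pow scalar_mult mult_scalar)
    have "s x \<otimes>\<^bsub>E\<^esub> s y = ?v x2 \<otimes>\<^bsub>E\<^esub> (?u x1 \<otimes>\<^bsub>E\<^esub> ?v y2) \<otimes>\<^bsub>E\<^esub> ?u y1"
      by (simp add: s_def xy E.m_assoc)
    also have "\<dots> = (?v x2 \<otimes>\<^bsub>E\<^esub> ?z) \<otimes>\<^bsub>E\<^esub> (?v y2 \<otimes>\<^bsub>E\<^esub> ?u x1 \<otimes>\<^bsub>E\<^esub> ?u y1)"
      by (simp add: comm E.m_assoc)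
    also have "\<dots> = ?z \<otimes>\<^bsub>E\<^esub> (?v (x2 + y2) \<otimes>\<^bsub>E\<^esub> ?u (x1 + y1))"
      by (simp add: zc E.m_assoc flip: E.nat_pow_mult)
    \<comment> \<open>This is where torsion of the lifts pays off: exponents wrap around without a
      scalar.\<close>
    also have "?v (x2 + y2) = ?v ((x2 + y2) mod k)"
      by (simp add: E.pow_mod_exponent vk)
    also have "?u (x1 + y1) = ?u ((x1 + y1) mod m)"
      by (simp add: E.pow_mod_exponent um)
    finally show ?thesis
      by (simp add: s_def xy mult_A z_pow nat_mod_distrib nat_add_distrib)
  qed
  show thesis
  proof (rule that[of \<zeta> "\<lambda>x. fst (s x)"])
    show "fst (s (0, 0)) = 1" by (simp add: s_def) (simp add: E_def)
    show "fst (s x) \<noteq> 0" if "x \<in> carrier A" for x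
      using s_closed[of x] by (auto simp: E_def)
    show "fst (s x) * fst (s y) * \<alpha> (x, y) = \<zeta> ^ (nat (fst x) * nat (snd y)) * fst (s (x \<otimes>\<^bsub>A\<^esub> y))"
      if "x \<in> carrier A" "y \<in> carrier A" for x y
    proof -
      have "s x = (fst (s x), x)" "s y = (fst (s y), y)"
        using snd_s that by (metis prod.collapse)+
      then have "s x \<otimes>\<^bsub>E\<^esub> s y = (fst (s x) * fst (s y) * \<alpha> (x, y), x \<otimes>\<^bsub>A\<^esub> y)"
        by (metis E_def central_extension_simps(2))
      then show ?thesis
        using s_mult[OF that] scalar_mult[OF s_closed] by simp
    qed
  qed (fact \<zeta>)+
qed

section \<open>Factor sets and coboundaries of skew braces\<close>

text \<open>The group axioms only see these three fields, so they pass between records that differ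
  elsewhere, as from \<open>DirProd\<close> to \<open>RDirProd\<close>.\<close>

lemma group_cong:
  assumes "group G" and "carrier H = carrier G" and "monoid.mult H = monoid.mult G"
    and "one H = one G"
  shows "group H"
proof (rule groupI)
  interpret G: group G by fact
  fix x assume "x \<in> carrier H"
  then show "\<exists>y\<in>carrier H. y \<otimes>\<^bsub>H\<^esub> x = \<one>\<^bsub>H\<^esub>"
    using assms(2-4) G.l_inv G.inv_closed by (metis (no_types))
qed (use assms monoid.m_assoc[OF group.is_monoid[OF assms(1)]]
      monoid.m_closed[OF group.is_monoid[OF assms(1)]]
      monoid.l_one[OF group.is_monoid[OF assms(1)]]
      monoid.one_closed[OF group.is_monoid[OF assms(1)]] in auto)

lemma RDirProd_simps:
  "monoid.mult (RDirProd A B) = (\<lambda>(a, b) (c, d). (a \<otimes>\<^bsub>A\<^esub> c, b \<otimes>\<^bsub>B\<^esub> d))"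
  "\<one>\<^bsub>RDirProd A B\<^esub> = (\<one>\<^bsub>A\<^esub>, \<one>\<^bsub>B\<^esub>)"
  "ring.add (RDirProd A B) = (\<lambda>(a, b) (c, d). (a \<oplus>\<^bsub>A\<^esub> c, b \<oplus>\<^bsub>B\<^esub> d))"
  "\<zero>\<^bsub>RDirProd A B\<^esub> = (\<zero>\<^bsub>A\<^esub>, \<zero>\<^bsub>B\<^esub>)"
  by (simp_all add: RDirProd_def DirProd_def monoid.defs)

lemma skew_brace_RDirProd:
  assumes "skew_brace A" and "skew_brace B"
  shows "skew_brace (RDirProd A B)"
proof -
  interpret A: skew_brace A by fact
  interpret B: skew_brace B by fact
  have minus: "\<ominus>\<^bsub>RDirProd A B\<^esub> (a, b) = (\<ominus>\<^bsub>A\<^esub> a, \<ominus>\<^bsub>B\<^esub> b)"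
    if "a \<in> carrier A" "b \<in> carrier B" for a b
    using that inv_DirProd[OF A.add_group B.add_group] unfolding a_inv_def RDirProd_add_monoid by simp
  show ?thesis
  proof (rule skew_brace.intro)
    show "Group.group (add_monoid (RDirProd A B))"
      by (rule group_cong[OF DirProd_group[OF A.add_group B.add_group]])
        (simp_all add: RDirProd_carrier RDirProd_simps DirProd_def)
    show "Group.group (RDirProd A B)"
      by (rule group_cong[OF DirProd_group[OF A.circ_group B.circ_group]])
        (simp_all add: RDirProd_carrier RDirProd_simps DirProd_def)
  next
    fix x y z
    assume "x \<in> carrier (RDirProd A B)" "y \<in> carrier (RDirProd A B)" "z \<in> carrier (RDirProd A B)"
    then show "x \<otimes>\<^bsub>RDirProd A B\<^esub> (y \<oplus>\<^bsub>RDirProd A B\<^esub> z) =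
        (x \<otimes>\<^bsub>RDirProd A B\<^esub> y \<ominus>\<^bsub>RDirProd A B\<^esub> x) \<oplus>\<^bsub>RDirProd A B\<^esub> (x \<otimes>\<^bsub>RDirProd A B\<^esub> z)"
      using A.brace B.brace
      by (auto simp: RDirProd_carrier RDirProd_simps a_minus_def minus)
  qed
qed

section \<open>Cochain pairs with complex coefficients and their subgroups\<close>

lemma complex_units_simps [simp]:
  "carrier complex_units = UNIV - {0}" "x \<otimes>\<^bsub>complex_units\<^esub> y = x * y" "\<one>\<^bsub>complex_units\<^esub> = 1"
  by (simp_all add: complex_units_def)

lemma group_complex_units: "group complex_units"
  using comm_group_complex_units by (simp add: comm_group_def)

lemma inv_complex_units [simp]: "x \<noteq> 0 \<Longrightarrow> inv\<^bsub>complex_units\<^esub> x = inverse x"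
  by (rule group.inv_equality[OF group_complex_units]) auto

text \<open>An ambient commutative group: factor sets and coboundaries are both subgroups of it, so
  that products and inverses are computed pointwise before membership is discussed.\<close>

definition cochain_pairs :: "('a, 'b) ring_scheme \<Rightarrow> (('a \<times> 'a \<Rightarrow> complex) \<times> ('a \<times> 'a \<Rightarrow> complex)) monoid"
  where "cochain_pairs Q =
    product_group (carrier Q \<times> carrier Q) (\<lambda>_. complex_units) \<times>\<times>
    product_group (carrier Q \<times> carrier Q) (\<lambda>_. complex_units)"

lemma cochain_pairs_simps [simp]:
  "carrier (cochain_pairs Q) =
    (carrier Q \<times> carrier Q \<rightarrow>\<^sub>E UNIV - {0}) \<times> (carrier Q \<times> carrier Q \<rightarrow>\<^sub>E UNIV - {0})"
  "(\<alpha>, \<mu>) \<otimes>\<^bsub>cochain_pairs Q\<^esub> (\<alpha>', \<mu>') =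
    (\<lambda>p\<in>carrier Q \<times> carrier Q. \<alpha> p * \<alpha>' p, \<lambda>p\<in>carrier Q \<times> carrier Q. \<mu> p * \<mu>' p)"
  "\<one>\<^bsub>cochain_pairs Q\<^esub> =
    (\<lambda>p\<in>carrier Q \<times> carrier Q. 1, \<lambda>p\<in>carrier Q \<times> carrier Q. 1)"
  by (simp_all add: cochain_pairs_def)

lemma group_cochain_pairs: "group (cochain_pairs Q)"
  unfolding cochain_pairs_def by (intro DirProd_group) (simp_all add: group_complex_units)

lemma comm_group_cochain_pairs: "comm_group (cochain_pairs Q)"
proof (rule group.group_comm_groupI[OF group_cochain_pairs])
  fix p q assume "p \<in> carrier (cochain_pairs Q)" "q \<in> carrier (cochain_pairs Q)"
  show "p \<otimes>\<^bsub>cochain_pairs Q\<^esub> q = q \<otimes>\<^bsub>cochain_pairs Q\<^esub> p"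
    by (cases p; cases q) (simp add: mult.commute)
qed

lemma inv_cochain_pairs:
  assumes "(\<alpha>, \<mu>) \<in> carrier (cochain_pairs Q)"
  shows "inv\<^bsub>cochain_pairs Q\<^esub> (\<alpha>, \<mu>) =
    (\<lambda>p\<in>carrier Q \<times> carrier Q. inverse (\<alpha> p), \<lambda>p\<in>carrier Q \<times> carrier Q. inverse (\<mu> p))"
  by (rule group.inv_equality[OF group_cochain_pairs])
    (use assms in \<open>auto simp: PiE_iff fun_eq_iff extensional_def\<close>)

lemma Z2b_complex_units: "Z2b Q complex_units = (cochain_pairs Q)\<lparr>carrier := factor_sets Q complex_units\<rparr>"
  by (simp add: Z2b_def cochain_pairs_def)

text \<open>With denominators cleared, every condition equates two products of values.\<close>

lemma factor_sets_complex_units_iff: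
  assumes "group (add_monoid Q)" and "group Q"
  shows "(\<alpha>, \<mu>) \<in> factor_sets Q complex_units \<longleftrightarrow>
    \<alpha> \<in> carrier Q \<times> carrier Q \<rightarrow>\<^sub>E UNIV - {0} \<and>
    \<mu> \<in> carrier Q \<times> carrier Q \<rightarrow>\<^sub>E UNIV - {0} \<and>
    (\<forall>x\<in>carrier Q. \<alpha> (\<zero>\<^bsub>Q\<^esub>, x) = 1 \<and> \<alpha> (x, \<zero>\<^bsub>Q\<^esub>) = 1) \<and>
    (\<forall>x\<in>carrier Q. \<mu> (\<zero>\<^bsub>Q\<^esub>, x) = 1 \<and> \<mu> (x, \<zero>\<^bsub>Q\<^esub>) = 1) \<and>
    (\<forall>x\<in>carrier Q. \<forall>y\<in>carrier Q. \<forall>z\<in>carrier Q.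
       \<alpha> (y, z) * \<alpha> (x, y \<oplus>\<^bsub>Q\<^esub> z) = \<alpha> (x \<oplus>\<^bsub>Q\<^esub> y, z) * \<alpha> (x, y)) \<and>
    (\<forall>x\<in>carrier Q. \<forall>y\<in>carrier Q. \<forall>z\<in>carrier Q.
       \<mu> (y, z) * \<mu> (x, y \<otimes>\<^bsub>Q\<^esub> z) = \<mu> (x \<otimes>\<^bsub>Q\<^esub> y, z) * \<mu> (x, y)) \<and>
    (\<forall>x\<in>carrier Q. \<forall>y\<in>carrier Q. \<forall>z\<in>carrier Q.
       \<alpha> (y, z) * \<mu> (x, y \<oplus>\<^bsub>Q\<^esub> z) * \<alpha> (\<ominus>\<^bsub>Q\<^esub> x, x) =
       \<mu> (x, z) * \<alpha> (x \<otimes>\<^bsub>Q\<^esub> y, \<ominus>\<^bsub>Q\<^esub> x) *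
         \<alpha> (x \<otimes>\<^bsub>Q\<^esub> y \<ominus>\<^bsub>Q\<^esub> x, x \<otimes>\<^bsub>Q\<^esub> z) * \<mu> (x, y))"
proof -
  interpret add: group "add_monoid Q" by fact
  interpret circ: group Q by fact
  have eq: "a * inverse b * c * inverse d = 1 \<longleftrightarrow> a * c = b * d" if "b \<noteq> 0" "d \<noteq> 0" for a b c d :: complex
    using that by (simp add: field_simps)
  have nz: "f p \<noteq> 0" if "f \<in> carrier Q \<times> carrier Q \<rightarrow>\<^sub>E UNIV - {0}" "p \<in> carrier Q \<times> carrier Q"
    for f :: "'a \<times> 'a \<Rightarrow> complex" and p
    using that by (auto simp: PiE_iff)
  have [simp]: "x \<oplus>\<^bsub>Q\<^esub> y \<in> carrier Q" if "x \<in> carrier Q" "y \<in> carrier Q" for x y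
    using add.m_closed that by simp
  show ?thesis
    unfolding factor_sets_def by (auto simp: nz eq)
qed

lemma coboundary_complex_units:
  assumes "h \<in> carrier G \<rightarrow> carrier complex_units" and "group G"
  shows "coboundary G complex_units h = (\<lambda>(x, y)\<in>carrier G \<times> carrier G. h x * h y / h (x \<otimes>\<^bsub>G\<^esub> y))"
  unfolding coboundary_def
proof (rule restrict_ext, safe)
  interpret group G by fact
  fix x y assume "x \<in> carrier G" "y \<in> carrier G"
  then have "h (x \<otimes>\<^bsub>G\<^esub> y) \<noteq> 0" using assms(1) m_closed by (auto simp: Pi_iff)
  then show "h y \<otimes>\<^bsub>complex_units\<^esub> inv\<^bsub>complex_units\<^esub> h (x \<otimes>\<^bsub>G\<^esub> y) \<otimes>\<^bsub>complex_units\<^esub> h x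
      = h x * h y / h (x \<otimes>\<^bsub>G\<^esub> y)"
    by (simp add: field_simps)
qed

text \<open>Each defining condition equates two monomials in the values of the pair, hence survives
  pointwise products and inverses.\<close>

lemma subgroup_factor_sets:
  assumes "group (add_monoid Q)" and "group Q"
  shows "subgroup (factor_sets Q complex_units) (cochain_pairs Q)"
proof -
  interpret add: group "add_monoid Q" by fact
  interpret circ: group Q by fact
  interpret P: comm_group "cochain_pairs Q" by (rule comm_group_cochain_pairs)
  note iff = factor_sets_complex_units_iff[OF assms]
  have [simp]: "x \<oplus>\<^bsub>Q\<^esub> y \<in> carrier Q" if "x \<in> carrier Q" "y \<in> carrier Q" for x y
    using add.m_closed that by simp
  have [simp]: "\<ominus>\<^bsub>Q\<^esub> x \<in> carrier Q" if "x \<in> carrier Q" for x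
    using add.inv_closed that by (simp add: a_inv_def)
  have [simp]: "x \<ominus>\<^bsub>Q\<^esub> y \<in> carrier Q" if "x \<in> carrier Q" "y \<in> carrier Q" for x y
    using that by (simp add: a_minus_def)
  have [simp]: "\<zero>\<^bsub>Q\<^esub> \<in> carrier Q" using add.one_closed by simp
  have sub: "factor_sets Q complex_units \<subseteq> carrier (cochain_pairs Q)"
    by (auto simp: factor_sets_def)
  \<comment> \<open>Shapes of the conditions: four values in a cocycle condition, seven in the
    compatibility condition.\<close>
  have mult4: "a * a' * (b * b') = c * c' * (d * d')" if "a * b = c * d" "a' * b' = c' * d'"
    for a b c d a' b' c' d' :: complex
    using that by (metis mult.assoc mult.left_commute)
  have mult7: "a * a' * (b * b') * (c * c') = d * d' * (e * e') * (f * f') * (r * r')"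
    if "a * b * c = d * e * f * r" "a' * b' * c' = d' * e' * f' * r'"
    for a b c d e f r a' b' c' d' e' f' r' :: complex
  proof -
    have "a * a' * (b * b') * (c * c') = (a * b * c) * (a' * b' * c')" by (simp add: ac_simps)
    also have "\<dots> = (d * e * f * r) * (d' * e' * f' * r')" using that by simp
    finally show ?thesis by (simp add: ac_simps)
  qed
  show ?thesis
  proof (rule P.subgroupI[OF sub])
    show "factor_sets Q complex_units \<noteq> {}"
    proof -
      have "(\<lambda>p\<in>carrier Q \<times> carrier Q. 1, \<lambda>p\<in>carrier Q \<times> carrier Q. 1) \<in> factor_sets Q complex_units"
        unfolding iff by auto
      then show ?thesis by blast
    qed
  next
    fix p assume p: "p \<in> factor_sets Q complex_units"
    obtain \<alpha> \<mu> where p_eq: "p = (\<alpha>, \<mu>)" by force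
    have "(\<alpha>, \<mu>) \<in> carrier (cochain_pairs Q)" using sub p p_eq by blast
    then show "inv\<^bsub>cochain_pairs Q\<^esub> p \<in> factor_sets Q complex_units"
      using p unfolding p_eq inv_cochain_pairs[OF \<open>(\<alpha>, \<mu>) \<in> _\<close>] iff
      by (auto simp: PiE_iff simp flip: inverse_mult_distrib)
  next
    fix p q assume pq: "p \<in> factor_sets Q complex_units" "q \<in> factor_sets Q complex_units"
    obtain \<alpha> \<mu> \<alpha>' \<mu>' where eq: "p = (\<alpha>, \<mu>)" "q = (\<alpha>', \<mu>')" by force
    show "p \<otimes>\<^bsub>cochain_pairs Q\<^esub> q \<in> factor_sets Q complex_units"
      using pq unfolding eq cochain_pairs_simps iff
      by (auto simp: PiE_iff intro!: mult4 mult7)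
  qed
qed

lemma (in skew_brace) B2b_complex_units:
  "B2b A complex_units =
    {(\<lambda>(x, y)\<in>carrier A \<times> carrier A. h x * h y / h (x \<oplus> y),
      \<lambda>(x, y)\<in>carrier A \<times> carrier A. h x * h y / h (x \<otimes> y)) | h.
     h \<in> carrier A \<rightarrow> UNIV - {0} \<and> h \<zero> = 1}"
proof -
  have "(coboundary (add_monoid A) complex_units h, coboundary A complex_units h) =
    (\<lambda>(x, y)\<in>carrier A \<times> carrier A. h x * h y / h (x \<oplus> y),
     \<lambda>(x, y)\<in>carrier A \<times> carrier A. h x * h y / h (x \<otimes> y))"
    if "h \<in> carrier A \<rightarrow> carrier complex_units" for h
    using that coboundary_complex_units[of h "add_monoid A", OF _ add_group]
      coboundary_complex_units[of h A, OF _ circ_group]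
    by simp
  then show ?thesis
    unfolding B2b_def by (intro Collect_cong ex_cong1) auto
qed

text \<open>Associativity gives the two cocycle conditions. In the compatibility condition the brace
  law identifies the element x circ (y + z) on the left with the last sum on the right; all
  intermediate values of \<open>h\<close> cancel, and \<open>h \<zero> = 1\<close> removes the
  denominator that comes from -x + x.\<close>

lemma (in skew_brace) B2b_subset_factor_sets: "B2b A complex_units \<subseteq> factor_sets A complex_units"
proof
  interpret add: group "add_monoid A" by (rule add_group)
  interpret circ: group A by (rule circ_group)
  have add_closed [simp]: "x \<oplus> y \<in> carrier A" if "x \<in> carrier A" "y \<in> carrier A" for x y
    using add.m_closed that by simp
  have neg_closed [simp]: "\<ominus> x \<in> carrier A" if "x \<in> carrier A" for x
    using add.inv_closed that by (simp add: a_inv_def)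
  have add_assoc: "x \<oplus> y \<oplus> z = x \<oplus> (y \<oplus> z)"
    if "x \<in> carrier A" "y \<in> carrier A" "z \<in> carrier A" for x y z
    using add.m_assoc that by simp
  have zero [simp]: "\<zero> \<in> carrier A" using add.one_closed by simp
  have add_zero [simp]: "\<zero> \<oplus> x = x" "x \<oplus> \<zero> = x" "\<ominus> x \<oplus> x = \<zero>" if "x \<in> carrier A" for x
    using add.l_one add.r_one add.l_inv that by (simp_all add: a_inv_def)
  have circ_zero [simp]: "\<zero> \<otimes> x = x" "x \<otimes> \<zero> = x" if "x \<in> carrier A" for x
    using circ.l_one circ.r_one that by (simp_all add: one_eq_zero)
  fix p assume "p \<in> B2b A complex_units"
  then obtain h where h: "h \<in> carrier A \<rightarrow> UNIV - {0}" "h \<zero> = 1"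
    and p: "p = (\<lambda>(x, y)\<in>carrier A \<times> carrier A. h x * h y / h (x \<oplus> y),
      \<lambda>(x, y)\<in>carrier A \<times> carrier A. h x * h y / h (x \<otimes> y))"
    unfolding B2b_complex_units by blast
  have nz [simp]: "h x \<noteq> 0" if "x \<in> carrier A" for x
    using h(1) that by (auto simp: Pi_iff)
  define \<alpha> \<mu> where "\<alpha> = (\<lambda>(x, y)\<in>carrier A \<times> carrier A. h x * h y / h (x \<oplus> y))"
    and "\<mu> = (\<lambda>(x, y)\<in>carrier A \<times> carrier A. h x * h y / h (x \<otimes> y))"
  have "p = (\<alpha>, \<mu>)" by (simp add: p \<alpha>_def \<mu>_def)
  moreover have "(\<alpha>, \<mu>) \<in> factor_sets A complex_units"
    unfolding factor_sets_complex_units_iff[OF add_group circ_group]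
  proof (intro conjI ballI)
    fix x y z assume xyz: "x \<in> carrier A" "y \<in> carrier A" "z \<in> carrier A"
    show "\<alpha> (y, z) * \<alpha> (x, y \<oplus> z) = \<alpha> (x \<oplus> y, z) * \<alpha> (x, y)"
      using xyz by (simp add: \<alpha>_def add_assoc)
    show "\<mu> (y, z) * \<mu> (x, y \<otimes> z) = \<mu> (x \<otimes> y, z) * \<mu> (x, y)"
      using xyz by (simp add: \<mu>_def circ.m_assoc)
    show "\<alpha> (y, z) * \<mu> (x, y \<oplus> z) * \<alpha> (\<ominus> x, x) =
       \<mu> (x, z) * \<alpha> (x \<otimes> y, \<ominus> x) * \<alpha> (x \<otimes> y \<ominus> x, x \<otimes> z) * \<mu> (x, y)"
      using xyz by (simp add: \<alpha>_def \<mu>_def a_minus_def brace h(2))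
  qed (auto simp: \<alpha>_def \<mu>_def h(2))
  ultimately show "p \<in> factor_sets A complex_units" by simp
qed

text \<open>The map \<open>D\<close> sends pointwise products of functions to products of pairs, so
  its image is closed under the group operations.\<close>

lemma (in skew_brace) subgroup_B2b: "subgroup (B2b A complex_units) (cochain_pairs A)"
proof -
  interpret add: group "add_monoid A" by (rule add_group)
  interpret circ: group A by (rule circ_group)
  interpret P: comm_group "cochain_pairs A" by (rule comm_group_cochain_pairs)
  have add_closed [simp]: "x \<oplus> y \<in> carrier A" if "x \<in> carrier A" "y \<in> carrier A" for x y
    using add.m_closed that by simp
  have zero [simp]: "\<zero> \<in> carrier A" using add.one_closed by simp
  define D where "D h = (\<lambda>(x, y)\<in>carrier A \<times> carrier A. h x * h y / h (x \<oplus> y),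
    \<lambda>(x, y)\<in>carrier A \<times> carrier A. h x * h y / h (x \<otimes> y))" for h :: "'a \<Rightarrow> complex"
  have B: "B2b A complex_units = {D h | h. h \<in> carrier A \<rightarrow> UNIV - {0} \<and> h \<zero> = 1}"
    unfolding B2b_complex_units D_def ..
  have mult: "D h \<otimes>\<^bsub>cochain_pairs A\<^esub> D h' = D (\<lambda>x. h x * h' x)" for h h'
    by (auto simp: D_def fun_eq_iff)
  have D_cong: "D h = D h'" if "\<And>x. x \<in> carrier A \<Longrightarrow> h x = h' x" for h h'
    using that by (auto simp: D_def intro!: restrict_ext)
  have one: "D (\<lambda>_. 1) = \<one>\<^bsub>cochain_pairs A\<^esub>"
    by (auto simp: D_def fun_eq_iff)
  have sub: "B2b A complex_units \<subseteq> carrier (cochain_pairs A)"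
    using B2b_subset_factor_sets subgroup.subset[OF subgroup_factor_sets[OF add_group circ_group]] by blast
  show ?thesis
  proof (rule P.subgroupI[OF sub])
    have "D (\<lambda>_. 1) \<in> B2b A complex_units" unfolding B by auto
    then show "B2b A complex_units \<noteq> {}" by blast
  next
    fix p assume p: "p \<in> B2b A complex_units"
    then obtain h where h: "p = D h" "h \<in> carrier A \<rightarrow> UNIV - {0}" "h \<zero> = 1" unfolding B by blast
    then have "(\<lambda>x. inverse (h x)) \<in> carrier A \<rightarrow> UNIV - {0}" by auto
    then have mem: "D (\<lambda>x. inverse (h x)) \<in> B2b A complex_units" unfolding B using h by auto
    have "D (\<lambda>x. inverse (h x)) \<otimes>\<^bsub>cochain_pairs A\<^esub> p = D (\<lambda>x. inverse (h x) * h x)"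
      by (simp add: h mult)
    also have "\<dots> = D (\<lambda>_. 1)"
      using h(2) by (intro D_cong) (auto simp: Pi_iff)
    finally have "inv\<^bsub>cochain_pairs A\<^esub> p = D (\<lambda>x. inverse (h x))"
      unfolding one using P.inv_equality sub p mem by blast
    then show "inv\<^bsub>cochain_pairs A\<^esub> p \<in> B2b A complex_units" using mem by simp
  next
    fix p q assume "p \<in> B2b A complex_units" "q \<in> B2b A complex_units"
    then obtain h h' where h: "p = D h" "h \<in> carrier A \<rightarrow> UNIV - {0}" "h \<zero> = 1"
      and h': "q = D h'" "h' \<in> carrier A \<rightarrow> UNIV - {0}" "h' \<zero> = 1" unfolding B by blast
    then have "(\<lambda>x. h x * h' x) \<in> carrier A \<rightarrow> UNIV - {0}" by (auto simp: Pi_iff)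
    then show "p \<otimes>\<^bsub>cochain_pairs A\<^esub> q \<in> B2b A complex_units"
      unfolding B h h' mult using h(3) h'(3) by auto
  qed
qed

section \<open>Products of bicyclic skew braces\<close>

lemma C_brace_simps [simp]:
  "carrier (C_brace n d) = {0..<int n}"
  "x \<otimes>\<^bsub>C_brace n d\<^esub> y = (x + y + int d * x * y) mod int n"
  "\<one>\<^bsub>C_brace n d\<^esub> = 0"
  "\<zero>\<^bsub>C_brace n d\<^esub> = 0"
  "x \<oplus>\<^bsub>C_brace n d\<^esub> y = (x + y) mod int n"
  by (simp_all add: C_brace_def)

text \<open>A generator of the multiplicative group is a unit modulo n: each of its circ-powers is a
  multiple of \<open>u\<close> modulo n, and 1 is among them. The inverse \<open>t\<close> is what
  later allows a linear formula to be fitted to a prescribed value at \<open>u\<close>.\<close>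

lemma C_brace_generator:
  assumes "bicyclic (C_brace n d)" and "n \<ge> 2"
  obtains u t where "u \<in> {0..<int n}"
    and "\<And>x. x \<in> {0..<int n} \<Longrightarrow> \<exists>j :: nat. x = u [^]\<^bsub>C_brace n d\<^esub> j"
    and "[u * t = 1] (mod int n)"
proof -
  let ?G = "C_brace n d"
  interpret group ?G using assms(1) by (simp add: bicyclic_def skew_brace_def)
  obtain u where u: "u \<in> carrier ?G" "subgroup_generated ?G {u} = ?G"
    using assms(1) unfolding bicyclic_def cyclic_group_def by blast
  then have "carrier ?G = generate ?G {u}"
    by (metis Int_insert_right_if1 Int_empty_right carrier_subgroup_generated)
  \<comment> \<open>The carrier is finite, so natural exponents already exhaust the generated
    subgroup.\<close>
  then have pow: "\<exists>j :: nat. x = u [^]\<^bsub>?G\<^esub> j" if "x \<in> carrier ?G" for x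
    using that generate_pow_on_finite_carrier[OF _ u(1)] by simp
  have mult: "\<exists>t. [u [^]\<^bsub>?G\<^esub> j = u * t] (mod int n)" for j :: nat
  proof (induction j)
    case 0
    have "[u [^]\<^bsub>?G\<^esub> (0 :: nat) = u * 0] (mod int n)" by simp
    then show ?case by blast
  next
    case (Suc j)
    then obtain t where t: "[u [^]\<^bsub>?G\<^esub> j = u * t] (mod int n)" ..
    have "[u [^]\<^bsub>?G\<^esub> Suc j = u [^]\<^bsub>?G\<^esub> j + u + int d * u [^]\<^bsub>?G\<^esub> j * u] (mod int n)"
      by (simp add: cong_def)
    also have "[u [^]\<^bsub>?G\<^esub> j + u + int d * u [^]\<^bsub>?G\<^esub> j * u = u * t + u + int d * (u * t) * u] (mod int n)"
      by (intro cong_add cong_mult t cong_refl)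
    also have "u * t + u + int d * (u * t) * u = u * (t + 1 + int d * t * u)"
      by (simp add: algebra_simps)
    finally show ?case by blast
  qed
  obtain j :: nat where "1 = u [^]\<^bsub>?G\<^esub> j" using pow[of 1] assms(2) by auto
  then obtain t where "[u * t = 1] (mod int n)" using mult[of j] by (auto simp: cong_sym_eq)
  then show thesis using that u(1) pow by auto
qed

text \<open>The assumptions are symmetric in the two factors, so statements about the first one
  transfer to the second by reinterpreting the locale with the factors exchanged.\<close>

locale bicyclic_brace_pair =
  fixes m k d1 d2 g :: nat
  assumes m: "m \<ge> 2" and k: "k \<ge> 2" and d1: "d1 dvd m" and d2: "d2 dvd k"
    and bicyclic1: "bicyclic (C_brace m d1)" and bicyclic2: "bicyclic (C_brace k d2)"
    and g: "g = gcd m k" and g': "g = gcd d1 d2"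
begin

abbreviation "Q \<equiv> RDirProd (C_brace m d1) (C_brace k d2)"

lemma skew_brace_Q: "skew_brace Q"
  using bicyclic1 bicyclic2 by (intro skew_brace_RDirProd) (simp_all add: bicyclic_def)

sublocale skew_brace Q by (rule skew_brace_Q)

lemma Q_simps:
  "carrier Q = {0..<int m} \<times> {0..<int k}"
  "\<zero>\<^bsub>Q\<^esub> = (0, 0)"
  "x \<oplus>\<^bsub>Q\<^esub> y = ((fst x + fst y) mod int m, (snd x + snd y) mod int k)"
  "x \<otimes>\<^bsub>Q\<^esub> y = ((fst x + fst y + int d1 * fst x * fst y) mod int m,
    (snd x + snd y + int d2 * snd x * snd y) mod int k)"
  by (simp_all add: RDirProd_carrier RDirProd_simps split: prod.split)

lemma minus_Q:
  assumes "x \<in> carrier Q"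
  shows "\<ominus>\<^bsub>Q\<^esub> x = (- fst x mod int m, - snd x mod int k)"
  unfolding a_inv_def
  by (rule group.inv_equality[OF add_group])
    (use assms m k in \<open>auto simp: Q_simps mod_simps\<close>)

lemma pos: "m > 0" "k > 0" "d1 > 0" "d2 > 0" "g > 0"
  using m k d1 d2 by (auto simp: g intro!: Nat.gr0I)

lemma g_dvd: "int g dvd int m" "int g dvd int k" "int g dvd int d1" "int g dvd int d2"
  by (simp_all add: g) (simp_all add: g' flip: g)

lemma circ_closed: "x \<in> carrier Q \<Longrightarrow> y \<in> carrier Q \<Longrightarrow> x \<otimes>\<^bsub>Q\<^esub> y \<in> carrier Q"
  using circ_group by (meson group.is_monoid monoid.m_closed)

text \<open>
  The groups of the two factors are cyclic, so a crossed homomorphism is determined by its values at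
  \<open>(u, 0)\<close> and \<open>(0, v)\<close> for generators \<open>u\<close>, \<open>v\<close>.
\<close>

lemma crossed_hom:
  assumes crossed: "\<And>x y. \<lbrakk>x \<in> carrier Q; y \<in> carrier Q\<rbrakk>
    \<Longrightarrow> [\<phi> (x \<otimes>\<^bsub>Q\<^esub> y) = \<phi> y + \<phi> x * (1 + int d1 * fst y)] (mod int m)"
  obtains a s where "\<And>x. x \<in> carrier Q
    \<Longrightarrow> [\<phi> x = a * fst x + int (m div g) * s * snd x] (mod int m)"
proof -
  obtain u u' where u: "u \<in> {0..<int m}"
      "\<And>x. x \<in> {0..<int m} \<Longrightarrow> \<exists>j :: nat. x = u [^]\<^bsub>C_brace m d1\<^esub> j" "[u * u' = 1] (mod int m)"
    using C_brace_generator[OF bicyclic1 m] by blast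
  obtain v v' where v: "v \<in> {0..<int k}"
      "\<And>x. x \<in> {0..<int k} \<Longrightarrow> \<exists>j :: nat. x = v [^]\<^bsub>C_brace k d2\<^esub> j" "[v * v' = 1] (mod int k)"
    using C_brace_generator[OF bicyclic2 k] by blast
  interpret N: group "C_brace m d1" using bicyclic1 by (simp add: bicyclic_def skew_brace_def)
  interpret T: group "C_brace k d2" using bicyclic2 by (simp add: bicyclic_def skew_brace_def)
  let ?u = "\<lambda>j :: nat. u [^]\<^bsub>C_brace m d1\<^esub> j" and ?v = "\<lambda>j :: nat. v [^]\<^bsub>C_brace k d2\<^esub> j"
  have u_pow: "(?u j, 0) \<in> carrier Q" and v_pow: "(0, ?v j) \<in> carrier Q" for j
    using N.nat_pow_closed[of u j] T.nat_pow_closed[of v j] u(1) v(1) pos by (auto simp: Q_simps)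
  have u_Suc: "(?u (Suc j), 0) = (?u j, 0) \<otimes>\<^bsub>Q\<^esub> (u, 0)"
    and v_Suc: "(0, ?v (Suc j)) = (0, ?v j) \<otimes>\<^bsub>Q\<^esub> (0, v)" for j
    by (simp_all add: Q_simps)
  have uv: "(u, 0) \<in> carrier Q" "(0, v) \<in> carrier Q" "(1, 0) \<in> carrier Q" "(0, 0) \<in> carrier Q"
    using u(1) v(1) m k by (auto simp: Q_simps)
  have zero: "[\<phi> (0, 0) = 0] (mod int m)"
    using crossed[OF uv(4) uv(4)] by (simp add: Q_simps cong_iff_dvd_diff)
  define w where "w = int (m div g)"
  have wg: "int m = w * int g"
    using g_dvd(1) by (simp add: w_def flip: of_nat_mult)
  \<comment> \<open>Modulo m = w * g, the cofactor of \<open>w\<close> matters only modulo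
    g.\<close>
  have w_cong: "[w * s * x = w * s * y] (mod int m)" if "[x = y] (mod int g)" for s x y
  proof -
    have "w * int g dvd w * (x - y)"
      using that by (simp add: cong_iff_dvd_diff)
    then have "w * int g dvd s * (w * (x - y))"
      by (rule dvd_mult)
    then show ?thesis
      by (simp add: wg cong_iff_dvd_diff algebra_simps)
  qed
  define b where "b = \<phi> (0, v)"
  \<comment> \<open>The elements (1, 0) and (0, v) commute, but the crossed rule treats the two
    orders differently; the discrepancy is b * d1.\<close>
  have b_d1: "int m dvd b * int d1"
  proof -
    have "(1, 0) \<otimes>\<^bsub>Q\<^esub> (0, v) = (0, v) \<otimes>\<^bsub>Q\<^esub> (1, 0)" by (simp add: Q_simps)
    then have "[\<phi> (0, v) + \<phi> (1, 0) = \<phi> (1, 0) + \<phi> (0, v) * (1 + int d1)] (mod int m)"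
      using crossed[OF uv(3) uv(2)] crossed[OF uv(2) uv(3)]
      by (simp add: cong_def)
    then have "int m dvd (\<phi> (1, 0) + \<phi> (0, v) * (1 + int d1)) - (\<phi> (0, v) + \<phi> (1, 0))"
      by (simp add: cong_iff_dvd_diff dvd_diff_commute)
    then show ?thesis by (simp add: b_def algebra_simps)
  qed
  \<comment> \<open>The first coordinate of (0, v) is 0, so the twisting factor is 1 and \<phi> is
    additive along the powers of \<open>v\<close>.\<close>
  have "[\<phi> (0, ?v j) = int j * b] (mod int m)" for j
  proof (induction j)
    case (Suc j)
    have "[\<phi> (0, ?v (Suc j)) = b + \<phi> (0, ?v j)] (mod int m)"
      using crossed[OF v_pow[of j] uv(2)] unfolding v_Suc b_def by simp
    also have "[b + \<phi> (0, ?v j) = b + int j * b] (mod int m)"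
      by (intro cong_add cong_refl Suc)
    finally show ?case by (simp add: algebra_simps)
  qed (use zero in simp)
  moreover have "?v k = 0"
    using T.pow_order_eq_1[of v] v(1) by (simp add: Coset.order_def)
  ultimately have "[0 = int k * b] (mod int m)"
    using zero by (metis cong_sym cong_trans)
  then have "int m dvd b * int k"
    by (simp add: cong_iff_dvd_diff mult.commute)
  then have b_k: "int m dvd b * int k" .
  \<comment> \<open>By Bezout, gcd(d1, k) kills \<open>b\<close> modulo m; since d1 divides m, this
    gcd divides gcd(m, k) = g.\<close>
  obtain x y where "x * int d1 + y * int k = gcd (int d1) (int k)"
    using bezout_int by blast
  then have "b * int (gcd d1 k) = x * (b * int d1) + y * (b * int k)"
    by (simp add: algebra_simps flip: gcd_int_int_eq) (metis distrib_left)
  then have "int m dvd b * int (gcd d1 k)"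
    using b_d1 b_k by simp
  moreover have "gcd d1 k dvd g" using d1 by (auto simp: g intro: dvd_trans)
  ultimately have "int m dvd b * int g"
    by (meson dvd_trans mult_dvd_mono dvd_refl int_dvd_int_iff)
  then obtain c where c: "b = w * c"
    using pos by (auto simp: wg)
  \<comment> \<open>Solves for the values of \<phi> at the two generators. The inverse
    \<open>v'\<close> is one modulo k, hence modulo g, which suffices because \<open>s\<close>
    occurs only behind the factor \<open>w\<close>.\<close>
  define a s where "a = \<phi> (u, 0) * u'" and "s = c * v'"
  define \<psi> where "\<psi> x = a * fst x + w * s * snd x" for x :: "int \<times> int"
  \<comment> \<open>The second coordinate sits behind \<open>w\<close>, so it may be altered by
    multiples of g: the term d2 * x2 * y2 is dropped because g divides d2, and d1 * x2 * y1, which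
    the twisting factor demands, is inserted because g divides d1.\<close>
  have crossed': "[\<psi> (x \<otimes>\<^bsub>Q\<^esub> y) = \<psi> y + \<psi> x * (1 + int d1 * fst y)] (mod int m)" for x y
  proof -
    let ?e1 = "fst x + fst y + int d1 * fst x * fst y"
    have g1: "[(snd x + snd y + int d2 * snd x * snd y) mod int k = snd x + snd y + 0] (mod int g)"
    proof -
      have "[(snd x + snd y + int d2 * snd x * snd y) mod int k = snd x + snd y + int d2 * snd x * snd y] (mod int g)"
        using g_dvd(2) by (simp add: cong_def mod_mod_cancel)
      also have "[snd x + snd y + int d2 * snd x * snd y = snd x + snd y + 0] (mod int g)"
        using g_dvd(4) by (intro cong_add cong_refl) (simp add: cong_0_iff)
      finally show ?thesis .
    qed
    have "[\<psi> (x \<otimes>\<^bsub>Q\<^esub> y) = a * ?e1 + w * s * (snd x + snd y + 0)] (mod int m)"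
      unfolding \<psi>_def Q_simps fst_conv snd_conv
      by (intro cong_add w_cong g1 cong_mult cong_refl) (simp add: cong_def)
    also have "[w * s * (snd x + snd y + 0) = w * s * (snd x + snd y + int d1 * snd x * fst y)] (mod int m)"
      using g_dvd(3) by (intro w_cong cong_add cong_refl) (simp add: cong_iff_dvd_diff)
    then have "[a * ?e1 + w * s * (snd x + snd y + 0) =
        a * ?e1 + w * s * (snd x + snd y + int d1 * snd x * fst y)] (mod int m)"
      by (intro cong_add cong_refl)
    also have "a * ?e1 + w * s * (snd x + snd y + int d1 * snd x * fst y) = \<psi> y + \<psi> x * (1 + int d1 * fst y)"
      by (simp add: \<psi>_def algebra_simps)
    finally show ?thesis .
  qed
  \<comment> \<open>Agreement of \<phi> and \<psi> is closed under circ, as both obey the same rule,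
    and so spreads from the generators. Membership is part of \<open>P\<close> because the rule for
    \<phi> is only available on the carrier.\<close>
  define P where "P x \<longleftrightarrow> x \<in> carrier Q \<and> [\<phi> x = \<psi> x] (mod int m)" for x
  have P_circ: "P (x \<otimes>\<^bsub>Q\<^esub> y)" if "P x" "P y" for x y
  proof -
    have xy: "x \<in> carrier Q" "y \<in> carrier Q" using that by (simp_all add: P_def)
    have "[\<phi> (x \<otimes>\<^bsub>Q\<^esub> y) = \<phi> y + \<phi> x * (1 + int d1 * fst y)] (mod int m)"
      by (rule crossed[OF xy])
    also have "[\<phi> y + \<phi> x * (1 + int d1 * fst y) = \<psi> y + \<psi> x * (1 + int d1 * fst y)] (mod int m)"
      using that by (intro cong_add cong_mult cong_refl) (simp_all add: P_def)
    also have "[\<psi> y + \<psi> x * (1 + int d1 * fst y) = \<psi> (x \<otimes>\<^bsub>Q\<^esub> y)] (mod int m)"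
      by (rule cong_sym[OF crossed'])
    finally show ?thesis using circ_closed[OF xy] by (simp add: P_def)
  qed
  have P_zero: "P (0, 0)" using zero uv by (simp add: P_def \<psi>_def)
  have "[\<phi> (u, 0) * (u * u') = \<phi> (u, 0) * 1] (mod int m)"
    by (intro cong_mult cong_refl u(3))
  then have P_u: "P (u, 0)"
    using uv by (simp add: P_def \<psi>_def a_def cong_sym_eq ac_simps)
  have "[w * c * (v * v') = w * c * 1] (mod int m)"
    using cong_dvd_modulus[OF v(3) g_dvd(2)] by (rule w_cong)
  then have P_v: "P (0, v)"
    using uv by (simp add: P_def \<psi>_def s_def b_def[symmetric] c cong_sym_eq ac_simps)
  have P_u_pow: "P (?u j, 0)" for j
    by (induction j) (use P_zero P_circ[OF _ P_u] in \<open>simp_all only: u_Suc\<close>, simp)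
  have P_v_pow: "P (0, ?v j)" for j
    by (induction j) (use P_zero P_circ[OF _ P_v] in \<open>simp_all only: v_Suc\<close>, simp)
  have "P x" if x: "x \<in> carrier Q" for x
  proof -
    obtain i j where "fst x = ?u i" "snd x = ?v j"
      using u(2)[of "fst x"] v(2)[of "snd x"] x by (auto simp: Q_simps)
    then have "P (fst x, 0)" "P (0, snd x)" using P_u_pow P_v_pow by simp_all
    moreover have "(fst x, 0) \<otimes>\<^bsub>Q\<^esub> (0, snd x) = x"
      using x by (auto simp: Q_simps)
    ultimately show ?thesis using P_circ by metis
  qed
  then show thesis using that[of a s] by (simp add: P_def \<psi>_def w_def)
qed

section \<open>Factor sets with bilinear additive part\<close>

abbreviation "C2 \<equiv> carrier Q \<times> carrier Q"

lemma add_closed: "x \<in> carrier Q \<Longrightarrow> y \<in> carrier Q \<Longrightarrow> x \<oplus>\<^bsub>Q\<^esub> y \<in> carrier Q"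
  using pos by (auto simp: Q_simps)

lemma minus_closed: "x \<in> carrier Q \<Longrightarrow> \<ominus>\<^bsub>Q\<^esub> x \<in> carrier Q"
  using pos by (auto simp: Q_simps minus_Q)

lemma cong_g_mod: "[x mod int m = x] (mod int g)" "[x mod int k = x] (mod int g)"
  using g_dvd by (simp_all add: cong_def mod_mod_cancel)

lemma cong_g_circ:
  "[(x + y + int d1 * x * y) mod int m = x + y] (mod int g)"
  "[(x + y + int d2 * x * y) mod int k = x + y] (mod int g)"
proof -
  have "[x + y + int d1 * x * y = x + y + 0] (mod int g)" "[x + y + int d2 * x * y = x + y + 0] (mod int g)"
    using g_dvd by (intro cong_add cong_refl; simp add: cong_0_iff)+
  then show "[(x + y + int d1 * x * y) mod int m = x + y] (mod int g)"
    "[(x + y + int d2 * x * y) mod int k = x + y] (mod int g)"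
    using cong_g_mod cong_trans by fastforce+
qed

lemma cong_g_add:
  "[fst (x \<oplus>\<^bsub>Q\<^esub> y) = fst x + fst y] (mod int g)" "[snd (x \<oplus>\<^bsub>Q\<^esub> y) = snd x + snd y] (mod int g)"
  by (simp_all add: Q_simps(3) cong_g_mod)

definition bilinear_cocycle :: "int \<Rightarrow> (int \<times> int) \<times> (int \<times> int) \<Rightarrow> complex"
  where "bilinear_cocycle r = (\<lambda>(x, y)\<in>C2. root_of_unity g (r * fst x * snd y))"

lemma bilinear_cocycle:
  "\<lbrakk>x \<in> carrier Q; y \<in> carrier Q\<rbrakk>
    \<Longrightarrow> bilinear_cocycle r (x, y) = root_of_unity g (r * fst x * snd y)"
  by (simp add: bilinear_cocycle_def)

text \<open>
  Since \<open>g\<close> divides \<open>d1\<close> and \<open>d2\<close>, the bilinear cocycle does not distinguish \<open>\<oplus>\<close> from \<open>\<otimes>\<close>, and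
  it cancels from the compatibility condition.
\<close>

lemma bilinear_factor_sets_iff:
  "(bilinear_cocycle r, \<mu>) \<in> factor_sets Q complex_units \<longleftrightarrow>
    \<mu> \<in> C2 \<rightarrow>\<^sub>E UNIV - {0} \<and>
    (\<forall>x\<in>carrier Q. \<mu> (\<zero>\<^bsub>Q\<^esub>, x) = 1 \<and> \<mu> (x, \<zero>\<^bsub>Q\<^esub>) = 1) \<and>
    (\<forall>x\<in>carrier Q. \<forall>y\<in>carrier Q. \<forall>z\<in>carrier Q.
       \<mu> (y, z) * \<mu> (x, y \<otimes>\<^bsub>Q\<^esub> z) = \<mu> (x \<otimes>\<^bsub>Q\<^esub> y, z) * \<mu> (x, y)) \<and>
    (\<forall>x\<in>carrier Q. \<forall>y\<in>carrier Q. \<forall>z\<in>carrier Q. \<mu> (x, y \<oplus>\<^bsub>Q\<^esub> z) = \<mu> (x, y) * \<mu> (x, z))"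
proof -
  let ?\<alpha> = "bilinear_cocycle r" and ?W = "root_of_unity g"
  have \<alpha>: "?\<alpha> \<in> C2 \<rightarrow>\<^sub>E UNIV - {0}"
    by (auto simp: bilinear_cocycle_def)
  have \<alpha>0: "\<forall>x\<in>carrier Q. ?\<alpha> (\<zero>\<^bsub>Q\<^esub>, x) = 1 \<and> ?\<alpha> (x, \<zero>\<^bsub>Q\<^esub>) = 1"
    using pos by (auto simp: bilinear_cocycle_def Q_simps)
  \<comment> \<open>Each coordinate that enters may be replaced by any representative modulo g, so
    the operations of \<open>Q\<close> turn into plain integer expressions.\<close>
  have \<alpha>_eq: "?\<alpha> (x, y) = ?W (r * p * q)"
    if "x \<in> carrier Q" "y \<in> carrier Q" "[fst x = p] (mod int g)" "[snd y = q] (mod int g)" for x y p q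
    using that root_of_unity_cong_mult[of _ _ g] pos by (simp add: bilinear_cocycle)
  have \<alpha>_cocycle: "?\<alpha> (y, z) * ?\<alpha> (x, y \<oplus>\<^bsub>Q\<^esub> z) = ?\<alpha> (x \<oplus>\<^bsub>Q\<^esub> y, z) * ?\<alpha> (x, y)"
    if xyz: "x \<in> carrier Q" "y \<in> carrier Q" "z \<in> carrier Q" for x y z
  proof -
    have "?\<alpha> (x, y \<oplus>\<^bsub>Q\<^esub> z) = ?W (r * fst x * (snd y + snd z))"
      and "?\<alpha> (x \<oplus>\<^bsub>Q\<^esub> y, z) = ?W (r * (fst x + fst y) * snd z)"
      by (rule \<alpha>_eq; intro add_closed cong_g_add cong_refl xyz)+
    then show ?thesis
      using xyz by (simp add: bilinear_cocycle algebra_simps flip: root_of_unity_add)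
  qed
  have compat: "?\<alpha> (y, z) * \<mu> (x, y \<oplus>\<^bsub>Q\<^esub> z) * ?\<alpha> (\<ominus>\<^bsub>Q\<^esub> x, x) =
       \<mu> (x, z) * ?\<alpha> (x \<otimes>\<^bsub>Q\<^esub> y, \<ominus>\<^bsub>Q\<^esub> x) *
         ?\<alpha> (x \<otimes>\<^bsub>Q\<^esub> y \<ominus>\<^bsub>Q\<^esub> x, x \<otimes>\<^bsub>Q\<^esub> z) * \<mu> (x, y) \<longleftrightarrow>
       \<mu> (x, y \<oplus>\<^bsub>Q\<^esub> z) = \<mu> (x, y) * \<mu> (x, z)"
    if xyz: "x \<in> carrier Q" "y \<in> carrier Q" "z \<in> carrier Q" for x y z
  proof -
    have 1: "?\<alpha> (y, z) = ?W (r * fst y * snd z)"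
      using xyz by (simp add: bilinear_cocycle)
    have 2: "?\<alpha> (\<ominus>\<^bsub>Q\<^esub> x, x) = ?W (r * (- fst x) * snd x)"
      using xyz by (intro \<alpha>_eq minus_closed cong_refl) (simp_all add: minus_Q cong_g_mod)
    have 3: "?\<alpha> (x \<otimes>\<^bsub>Q\<^esub> y, \<ominus>\<^bsub>Q\<^esub> x) = ?W (r * (fst x + fst y) * (- snd x))"
      using xyz by (intro \<alpha>_eq minus_closed circ_closed)
        (simp_all add: minus_Q cong_g_mod Q_simps(4) cong_g_circ)
    have "[fst (x \<otimes>\<^bsub>Q\<^esub> y \<ominus>\<^bsub>Q\<^esub> x) = fst (x \<otimes>\<^bsub>Q\<^esub> y) + fst (\<ominus>\<^bsub>Q\<^esub> x)] (mod int g)"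
      by (simp add: a_minus_def Q_simps(3) cong_g_mod)
    also have "[fst (x \<otimes>\<^bsub>Q\<^esub> y) + fst (\<ominus>\<^bsub>Q\<^esub> x) = (fst x + fst y) + (- fst x)] (mod int g)"
      by (rule cong_add) (use xyz in \<open>simp_all add: minus_Q Q_simps(4) cong_g_mod cong_g_circ\<close>)
    finally have "[fst (x \<otimes>\<^bsub>Q\<^esub> y \<ominus>\<^bsub>Q\<^esub> x) = fst y] (mod int g)" by simp
    then have 4: "?\<alpha> (x \<otimes>\<^bsub>Q\<^esub> y \<ominus>\<^bsub>Q\<^esub> x, x \<otimes>\<^bsub>Q\<^esub> z) = ?W (r * fst y * (snd x + snd z))"
      using xyz by (intro \<alpha>_eq) (simp_all add: a_minus_def add_closed circ_closed minus_closed, simp add: Q_simps(4) cong_g_circ)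
    \<comment> \<open>The common factor of both sides, with exponent r (y1 z2 - x1 x2); on the right
      it arises from -(x1 + y1) x2 + y1 (x2 + z2).\<close>
    define K where "K = ?W (r * fst y * snd z) * ?W (r * (- fst x) * snd x)"
    have K: "K \<noteq> 0" by (simp add: K_def)
    have "?W (r * (fst x + fst y) * (- snd x)) * ?W (r * fst y * (snd x + snd z)) = K"
      by (simp add: K_def algebra_simps flip: root_of_unity_add)
    moreover have "p * v * w * q = v * w * (q * p)" for p q v w :: complex by (simp add: ac_simps)
    ultimately have rhs: "\<mu> (x, z) * ?W (r * (fst x + fst y) * (- snd x)) * ?W (r * fst y * (snd x + snd z)) * \<mu> (x, y)
        = K * (\<mu> (x, y) * \<mu> (x, z))"
      by simp
    have lhs: "?W (r * fst y * snd z) * \<mu> (x, y \<oplus>\<^bsub>Q\<^esub> z) * ?W (r * (- fst x) * snd x)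
        = K * \<mu> (x, y \<oplus>\<^bsub>Q\<^esub> z)"
      by (simp add: K_def ac_simps)
    show ?thesis
      by (simp only: 1 2 3 4 lhs rhs mult_cancel_left K simp_thms)
  qed
  show ?thesis
    unfolding factor_sets_complex_units_iff[OF add_group circ_group]
    using \<alpha> \<alpha>0 \<alpha>_cocycle compat by (simp cong: conj_cong ball_cong)
qed

text \<open>By additivity in the second argument, the values at (1, 0) determine everything on the
  first factor. They are m-th roots of unity, and their exponents form a crossed
  homomorphism.\<close>

lemma crossed_character:
  assumes nonzero: "\<And>x y. \<lbrakk>x \<in> carrier Q; y \<in> carrier Q\<rbrakk> \<Longrightarrow> \<mu> (x, y) \<noteq> 0"
    and add: "\<And>x y z. \<lbrakk>x \<in> carrier Q; y \<in> carrier Q; z \<in> carrier Q\<rbrakk>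
      \<Longrightarrow> \<mu> (x, y \<oplus>\<^bsub>Q\<^esub> z) = \<mu> (x, y) * \<mu> (x, z)"
    and cocycle: "\<And>x y z. \<lbrakk>x \<in> carrier Q; y \<in> carrier Q; z \<in> carrier Q\<rbrakk>
      \<Longrightarrow> \<mu> (y, z) * \<mu> (x, y \<otimes>\<^bsub>Q\<^esub> z) = \<mu> (x \<otimes>\<^bsub>Q\<^esub> y, z) * \<mu> (x, y)"
  obtains a s where "\<And>x i. \<lbrakk>x \<in> carrier Q; i \<in> {0..<int m}\<rbrakk>
    \<Longrightarrow> \<mu> (x, (i, 0)) = root_of_unity m (a * fst x * i) * root_of_unity g (s * snd x * i)"
proof -
  let ?W = "root_of_unity m"
  define F where "F x = \<mu> (x, (1, 0))" for x
  have one: "(1, 0) \<in> carrier Q" and zero: "(0, 0) \<in> carrier Q" and i0: "(i mod int m, 0) \<in> carrier Q" for i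
    using m k by (auto simp: Q_simps)
  have \<mu>_pow: "\<mu> (x, (int i mod int m, 0)) = F x ^ i" if x: "x \<in> carrier Q" for x i
  proof (induction i)
    case 0
    show ?case using add[OF x zero zero] nonzero[OF x zero] by (simp add: Q_simps)
  next
    case (Suc i)
    have "(int (Suc i) mod int m, 0) = (int i mod int m, 0) \<oplus>\<^bsub>Q\<^esub> (1, 0)"
      by (simp add: Q_simps mod_simps add.commute)
    then show ?case using add[OF x i0 one, of "int i"] Suc by (simp add: F_def)
  qed
  have F_nz: "F x \<noteq> 0" if "x \<in> carrier Q" for x
    using nonzero[OF that one] by (simp add: F_def)
  have "F x ^ m = 1" if "x \<in> carrier Q" for x
    using \<mu>_pow[OF that, of m] \<mu>_pow[OF that, of 0] by simp
  then have "\<exists>t. F x = ?W t" if "x \<in> carrier Q" for x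
    using obtain_root_of_unity pos(1) that by metis
  \<comment> \<open>The exponent is a choice, determined only modulo m; hence all rules for \<phi>
    are congruences.\<close>
  then obtain \<phi> where \<phi>: "F x = ?W (\<phi> x)" if "x \<in> carrier Q" for x
    by metis
  have \<mu>_int: "\<mu> (x, (i mod int m, 0)) = ?W (\<phi> x * i)" if x: "x \<in> carrier Q" for x i
  proof -
    have "\<mu> (x, (i mod int m, 0)) = F x ^ nat (i mod int m)"
      using \<mu>_pow[OF x, of "nat (i mod int m)"] pos by simp
    also have "\<dots> = ?W (\<phi> x * (i mod int m))"
      using pos by (simp add: \<phi> x root_of_unity_power mult.commute)
    also have "\<dots> = ?W (\<phi> x * i)"
      using pos by (simp add: root_of_unity_cong_iff cong_def mod_simps)
    finally show ?thesis .
  qed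
  have "[\<phi> (x \<otimes>\<^bsub>Q\<^esub> y) = \<phi> y + \<phi> x * (1 + int d1 * fst y)] (mod int m)"
    if xy: "x \<in> carrier Q" "y \<in> carrier Q" for x y
  proof -
    \<comment> \<open>Origin of the twisting factor: y circ (1, 0) = y + (1 + d1 * y1, 0), and \<mu>
      is additive in its second argument.\<close>
    let ?j = "1 + int d1 * fst y"
    have "y \<otimes>\<^bsub>Q\<^esub> (1, 0) = y \<oplus>\<^bsub>Q\<^esub> (?j mod int m, 0)"
      by (simp add: Q_simps mod_simps algebra_simps)
    then have "\<mu> (x, y \<otimes>\<^bsub>Q\<^esub> (1, 0)) = \<mu> (x, y) * ?W (\<phi> x * ?j)"
      using add[OF xy i0] \<mu>_int[OF xy(1)] by simp
    then have "F y * ?W (\<phi> x * ?j) = F (x \<otimes>\<^bsub>Q\<^esub> y)"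
      using cocycle[OF xy one] nonzero[OF xy] by (simp add: F_def)
    then have "?W (\<phi> (x \<otimes>\<^bsub>Q\<^esub> y)) = ?W (\<phi> y + \<phi> x * ?j)"
      using xy by (simp add: \<phi> circ_closed root_of_unity_add)
    then show ?thesis
      using pos by (simp add: root_of_unity_cong_iff)
  qed
  then obtain a s where \<phi>_eq: "[\<phi> x = a * fst x + int (m div g) * s * snd x] (mod int m)"
    if "x \<in> carrier Q" for x
    using crossed_hom[of \<phi>] by metis
  \<comment> \<open>The multiples of m/g among the exponents are exactly what produces g-th roots,
    so the term with \<open>s\<close> is free of m.\<close>
  have rescale: "?W (int (m div g) * t) = root_of_unity g t" for t
  proof -
    have m_eq: "real m = real (m div g) * real g"
      using g_dvd(1) by (simp flip: of_nat_mult)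
    have nz: "real (m div g) \<noteq> 0"
    proof
      assume "real (m div g) = 0"
      then show False using m_eq pos(1) by (simp only: mult_zero_left of_nat_eq_0_iff)
    qed
    have num: "2 * pi * real_of_int (int (m div g) * t) = real (m div g) * (2 * pi * real_of_int t)"
      by simp
    have "2 * pi * real_of_int (int (m div g) * t) / real m = 2 * pi * real_of_int t / real g"
      by (subst num, subst m_eq, rule nonzero_mult_divide_mult_cancel_left[OF nz])
    then show ?thesis
      by (simp only: root_of_unity_def)
  qed
  show thesis
  proof (rule that[of a s])
    fix x i assume x: "x \<in> carrier Q" and i: "i \<in> {0..<int m}"
    have "\<mu> (x, (i, 0)) = ?W (\<phi> x * i)"
      using \<mu>_int[OF x, of i] i by simp
    also have "\<dots> = ?W ((a * fst x + int (m div g) * s * snd x) * i)"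
      using \<phi>_eq[OF x] pos by (simp add: root_of_unity_cong_iff cong_mult)
    also have "(a * fst x + int (m div g) * s * snd x) * i = a * fst x * i + int (m div g) * (s * snd x * i)"
      by (simp add: algebra_simps)
    finally show "\<mu> (x, (i, 0)) = ?W (a * fst x * i) * root_of_unity g (s * snd x * i)"
      by (simp add: root_of_unity_add rescale)
  qed
qed

section \<open>Exchange of the factors and the standard factor sets\<close>

lemma swapped: "bicyclic_brace_pair k m d2 d1 g"
proof (rule bicyclic_brace_pair.intro)
  show "g = gcd k m" by (subst gcd.commute) (rule g)
  show "g = gcd d2 d1" by (subst gcd.commute) (rule g')
qed (fact m k d1 d2 bicyclic1 bicyclic2)+

text \<open>A product of four pairings, one for each choice of coordinates. The mixed ones take g-th
  roots of unity as values, since a pairing of Z/(m) with Z/(k) has values killed by both m and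
  k.\<close>

definition character_part :: "int \<Rightarrow> int \<Rightarrow> int \<Rightarrow> int \<Rightarrow> int \<times> int \<Rightarrow> int \<times> int \<Rightarrow> complex"
  where "character_part a b s t x y =
    root_of_unity m (a * fst x * fst y) * root_of_unity k (b * snd x * snd y) *
    root_of_unity g (s * snd x * fst y) * root_of_unity g (t * fst x * snd y)"

text \<open>The parameters are integers and not residues, which makes this a homomorphism on Z^5;
  residues only appear when coboundaries are divided out.\<close>

definition standard_factor_set ::
    "int \<times> int \<times> int \<times> int \<times> int
      \<Rightarrow> ((int \<times> int) \<times> (int \<times> int) \<Rightarrow> complex) \<times> ((int \<times> int) \<times> (int \<times> int) \<Rightarrow> complex)"
  where "standard_factor_set = (\<lambda>(a, b, r, s, t).
    (bilinear_cocycle r, \<lambda>(x, y)\<in>C2. character_part a b s t x y))"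

lemma character_part_add:
  "character_part a b s t x (y \<oplus>\<^bsub>Q\<^esub> z) = character_part a b s t x y * character_part a b s t x z"
proof -
  have "[fst (y \<oplus>\<^bsub>Q\<^esub> z) = fst y + fst z] (mod int m)" "[snd (y \<oplus>\<^bsub>Q\<^esub> z) = snd y + snd z] (mod int k)"
    by (simp_all add: Q_simps cong_def)
  then show ?thesis
    unfolding character_part_def
    by (simp only: root_of_unity_add_right[OF _ pos(1)] root_of_unity_add_right[OF _ pos(2)]
        root_of_unity_add_right[OF cong_g_add(1) pos(5)] root_of_unity_add_right[OF cong_g_add(2) pos(5)]) (simp only: ac_simps)
qed

text \<open>True for each of the four pairings separately. The diagonal ones use the symmetric
  expansion of the exponent; for the mixed ones circ and + agree modulo g, and bilinearity is
  enough.\<close>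

lemma character_part_cocycle:
  "character_part a b s t y z * character_part a b s t x (y \<otimes>\<^bsub>Q\<^esub> z) =
    character_part a b s t (x \<otimes>\<^bsub>Q\<^esub> y) z * character_part a b s t x y"
proof -
  let ?W = root_of_unity and ?p = "x \<otimes>\<^bsub>Q\<^esub> y" and ?q = "y \<otimes>\<^bsub>Q\<^esub> z"
  have 1: "?W m (a * fst y * fst z) * ?W m (a * fst x * fst ?q) = ?W m (a * fst ?p * fst z) * ?W m (a * fst x * fst y)"
    by (rule root_of_unity_circ_cocycle[OF _ _ pos(1)]) (simp_all add: Q_simps cong_def)
  have 2: "?W k (b * snd y * snd z) * ?W k (b * snd x * snd ?q) = ?W k (b * snd ?p * snd z) * ?W k (b * snd x * snd y)"
    by (rule root_of_unity_circ_cocycle[OF _ _ pos(2)]) (simp_all add: Q_simps cong_def)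
  have g_circ: "[fst (u \<otimes>\<^bsub>Q\<^esub> v) = fst u + fst v] (mod int g)" "[snd (u \<otimes>\<^bsub>Q\<^esub> v) = snd u + snd v] (mod int g)" for u v
    by (simp_all add: Q_simps(4) cong_g_circ)
  have 3: "?W g (s * snd y * fst z) * ?W g (s * snd x * fst ?q) = ?W g (s * snd ?p * fst z) * ?W g (s * snd x * fst y)"
    by (simp only: root_of_unity_add_right[OF g_circ(1) pos(5)] root_of_unity_add_left[OF g_circ(2) pos(5)]) (simp only: ac_simps)
  have 4: "?W g (t * fst y * snd z) * ?W g (t * fst x * snd ?q) = ?W g (t * fst ?p * snd z) * ?W g (t * fst x * snd y)"
    by (simp only: root_of_unity_add_right[OF g_circ(2) pos(5)] root_of_unity_add_left[OF g_circ(1) pos(5)]) (simp only: ac_simps)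
  have "(p1 * p2 * p3 * p4) * (q1 * q2 * q3 * q4) = (u1 * u2 * u3 * u4) * (v1 * v2 * v3 * v4)"
    if "p1 * q1 = u1 * v1" "p2 * q2 = u2 * v2" "p3 * q3 = u3 * v3" "p4 * q4 = u4 * v4"
    for p1 p2 p3 p4 q1 q2 q3 q4 u1 u2 u3 u4 v1 v2 v3 v4 :: complex
  proof -
    have "(p1 * p2 * p3 * p4) * (q1 * q2 * q3 * q4) = (p1 * q1) * (p2 * q2) * (p3 * q3) * (p4 * q4)"
      by (simp only: ac_simps)
    also have "\<dots> = (u1 * u2 * u3 * u4) * (v1 * v2 * v3 * v4)"
      unfolding that by (simp only: ac_simps)
    finally show ?thesis .
  qed
  from this[OF 1 2 3 4] show ?thesis by (simp only: character_part_def)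
qed

lemma standard_factor_set_mem: "standard_factor_set p \<in> factor_sets Q complex_units"
proof -
  obtain a b r s t where p: "p = (a, b, r, s, t)" by (metis prod_cases5)
  have zero: "(0, 0) \<in> carrier Q" using pos by (simp add: Q_simps)
  have "(\<lambda>(x, y)\<in>C2. character_part a b s t x y) \<in> C2 \<rightarrow>\<^sub>E UNIV - {0}"
    by (auto simp: character_part_def)
  then show ?thesis
    using character_part_cocycle character_part_add
    by (simp add: p standard_factor_set_def bilinear_factor_sets_iff add_closed circ_closed zero Q_simps(2))
      (simp add: character_part_def)
qed

lemma standard_factor_set_add:
  "standard_factor_set (a + a', b + b', r + r', s + s', t + t') =
    standard_factor_set (a, b, r, s, t) \<otimes>\<^bsub>cochain_pairs Q\<^esub> standard_factor_set (a', b', r', s', t')"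
proof -
  have "bilinear_cocycle (r + r') = (\<lambda>p\<in>C2. bilinear_cocycle r p * bilinear_cocycle r' p)"
    by (auto simp: bilinear_cocycle_def distrib_right root_of_unity_add intro!: restrict_ext)
  moreover have "(\<lambda>(x, y)\<in>C2. character_part (a + a') (b + b') (s + s') (t + t') x y) =
      (\<lambda>p\<in>C2. (\<lambda>(x, y)\<in>C2. character_part a b s t x y) p * (\<lambda>(x, y)\<in>C2. character_part a' b' s' t' x y) p)"
    by (auto simp: character_part_def distrib_right root_of_unity_add intro!: restrict_ext)
  ultimately show ?thesis
    by (simp only: standard_factor_set_def cochain_pairs_simps prod.case)
qed

lemma standard_factor_set_mem_B2b_iff:
  "standard_factor_set (a, b, r, s, t) \<in> B2b Q complex_units \<longleftrightarrow>
    int d1 dvd a \<and> int d2 dvd b \<and> int g dvd r \<and> int g dvd s \<and> int g dvd t"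
proof
  assume "standard_factor_set (a, b, r, s, t) \<in> B2b Q complex_units"
  then obtain h where h: "h \<in> carrier Q \<rightarrow> UNIV - {0}"
    and \<alpha>_eq: "bilinear_cocycle r = (\<lambda>(x, y)\<in>C2. h x * h y / h (x \<oplus>\<^bsub>Q\<^esub> y))"
    and \<mu>_eq: "(\<lambda>(x, y)\<in>C2. character_part a b s t x y) = (\<lambda>(x, y)\<in>C2. h x * h y / h (x \<otimes>\<^bsub>Q\<^esub> y))"
    by (auto simp: B2b_complex_units standard_factor_set_def)
  have \<alpha>: "root_of_unity g (r * fst x * snd y) = h x * h y / h (x \<oplus>\<^bsub>Q\<^esub> y)"
    if "x \<in> carrier Q" "y \<in> carrier Q" for x y
    using fun_cong[OF \<alpha>_eq, of "(x, y)"] that by (simp add: bilinear_cocycle_def)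
  have \<mu>: "character_part a b s t x y = h x * h y / h (x \<otimes>\<^bsub>Q\<^esub> y)"
    if "x \<in> carrier Q" "y \<in> carrier Q" for x y
    using fun_cong[OF \<mu>_eq, of "(x, y)"] that by simp
  have nz: "h x \<noteq> 0" if "x \<in> carrier Q" for x using h that by auto
  have e: "(1, 0) \<in> carrier Q" "(0, 1) \<in> carrier Q" using m k by (auto simp: Q_simps)
  have e_ops: "(1, 0) \<oplus>\<^bsub>Q\<^esub> (0, 1) = (1, 1)" "(0, 1) \<oplus>\<^bsub>Q\<^esub> (1, 0) = (1, 1)"
    "(1, 0) \<otimes>\<^bsub>Q\<^esub> (0, 1) = (1, 1)" "(0, 1) \<otimes>\<^bsub>Q\<^esub> (1, 0) = (1, 1)"
    using m k by (simp_all add: Q_simps)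
  \<comment> \<open>An additive coboundary is symmetric because addition is commutative, whereas the
    bilinear cocycle takes the values \<zeta>^r and 1 at the two orderings of (1, 0), (0, 1), with
    \<zeta> the g-th root of exponent 1.\<close>
  have "root_of_unity g r = 1"
    using \<alpha>[OF e] \<alpha>[OF e(2) e(1)] by (simp add: e_ops mult.commute)
  then have r: "int g dvd r" using pos by (simp add: root_of_unity_eq_1_iff)
  have h_add: "h (x \<oplus>\<^bsub>Q\<^esub> y) = h x * h y" if "x \<in> carrier Q" "y \<in> carrier Q" for x y
  proof -
    have "root_of_unity g (r * fst x * snd y) = 1"
      using r pos by (simp add: root_of_unity_eq_1_iff)
    then show ?thesis using \<alpha>[OF that] nz[OF add_closed[OF that]] by simp
  qed
  \<comment> \<open>On (1, 0) and (0, 1) the two operations of \<open>Q\<close> coincide, so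
    additivity of \<open>h\<close> makes the multiplicative coboundary trivial there, in both
    orders.\<close>
  have "root_of_unity g s = 1" "root_of_unity g t = 1"
    using \<mu>[OF e] \<mu>[OF e(2) e(1)] h_add[OF e] nz[OF e(1)] nz[OF e(2)]
    by (simp_all add: e_ops character_part_def)
  then have st: "int g dvd s" "int g dvd t" using pos by (simp_all add: root_of_unity_eq_1_iff)
  have a: "int d1 dvd a"
  proof (rule dvd_if_character[of m d1 "\<lambda>i. h (i, 0)"])
    show "h ((i + j) mod int m, 0) = h (i, 0) * h (j, 0)" if "i \<in> {0..<int m}" "j \<in> {0..<int m}" for i j
      using h_add[of "(i, 0)" "(j, 0)"] that pos by (simp add: Q_simps)
    show "h (i, 0) \<noteq> 0" if "i \<in> {0..<int m}" for i
      using nz[of "(i, 0)"] that pos by (simp add: Q_simps)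
    show "root_of_unity m a = h (1, 0) * h (1, 0) / h ((2 + int d1) mod int m, 0)"
      using \<mu>[OF e(1) e(1)] by (simp add: character_part_def Q_simps)
  qed (use m d1 in auto)
  have b: "int d2 dvd b"
  proof (rule dvd_if_character[of k d2 "\<lambda>i. h (0, i)"])
    show "h (0, (i + j) mod int k) = h (0, i) * h (0, j)" if "i \<in> {0..<int k}" "j \<in> {0..<int k}" for i j
      using h_add[of "(0, i)" "(0, j)"] that pos by (simp add: Q_simps)
    show "h (0, i) \<noteq> 0" if "i \<in> {0..<int k}" for i
      using nz[of "(0, i)"] that pos by (simp add: Q_simps)
    show "root_of_unity k b = h (0, 1) * h (0, 1) / h (0, (2 + int d2) mod int k)"
      using \<mu>[OF e(2) e(2)] by (simp add: character_part_def Q_simps)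
  qed (use k d2 in auto)
  show "int d1 dvd a \<and> int d2 dvd b \<and> int g dvd r \<and> int g dvd s \<and> int g dvd t"
    using a b r st by blast
next
  assume dvd: "int d1 dvd a \<and> int d2 dvd b \<and> int g dvd r \<and> int g dvd s \<and> int g dvd t"
  then obtain a' b' where ab: "a = int d1 * a'" "b = int d2 * b'" by (auto elim!: dvdE)
  have trivial: "root_of_unity g (r * x * y) = 1" "root_of_unity g (s * x * y) = 1"
    "root_of_unity g (t * x * y) = 1" for x y
    using dvd pos by (simp_all add: root_of_unity_eq_1_iff)
  \<comment> \<open>The sign is negative because a coboundary divides by the value at x circ y: the
    linear terms cancel and d1 * a' * x1 * y1 remains with a plus, likewise for the second
    coordinate.\<close>
  define h where "h x = root_of_unity m (- a' * fst x) * root_of_unity k (- b' * snd x)" for x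
  have h_cong: "h x = root_of_unity m (- a' * i) * root_of_unity k (- b' * j)"
    if "[fst x = i] (mod int m)" "[snd x = j] (mod int k)" for x i j
  proof -
    have "root_of_unity m (- a' * fst x) = root_of_unity m (- a' * i)"
      by (intro root_of_unity_cong_iff[THEN iffD2] cong_mult cong_refl that pos)
    moreover have "root_of_unity k (- b' * snd x) = root_of_unity k (- b' * j)"
      by (intro root_of_unity_cong_iff[THEN iffD2] cong_mult cong_refl that pos)
    ultimately show ?thesis by (simp only: h_def)
  qed
  have h_add: "h x * h y / h (x \<oplus>\<^bsub>Q\<^esub> y) = 1" for x y
  proof -
    have "h (x \<oplus>\<^bsub>Q\<^esub> y) = root_of_unity m (- a' * (fst x + fst y)) * root_of_unity k (- b' * (snd x + snd y))"
      by (rule h_cong) (simp_all add: Q_simps cong_def)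
    also have "\<dots> = h x * h y"
      by (simp only: h_def distrib_left root_of_unity_add ac_simps)
    finally show ?thesis by (simp add: h_def)
  qed
  have char_eq: "character_part a b s t x y = h x * h y / h (x \<otimes>\<^bsub>Q\<^esub> y)" for x y
  proof -
    let ?i = "- a' * (fst x + fst y + int d1 * fst x * fst y)" and ?j = "- b' * (snd x + snd y + int d2 * snd x * snd y)"
    have "h (x \<otimes>\<^bsub>Q\<^esub> y) = root_of_unity m ?i * root_of_unity k ?j"
      by (rule h_cong) (simp_all add: Q_simps cong_def)
    moreover have "character_part a b s t x y = root_of_unity m (a * fst x * fst y) * root_of_unity k (b * snd x * snd y)"
      by (simp only: character_part_def trivial mult_1_right)
    ultimately have "character_part a b s t x y * h (x \<otimes>\<^bsub>Q\<^esub> y) =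
        (root_of_unity m (a * fst x * fst y) * root_of_unity m ?i) *
        (root_of_unity k (b * snd x * snd y) * root_of_unity k ?j)"
      by (simp only: ac_simps)
    also have "\<dots> = root_of_unity m (a * fst x * fst y + ?i) * root_of_unity k (b * snd x * snd y + ?j)"
      by (simp only: root_of_unity_add)
    also have "a * fst x * fst y + ?i = - a' * fst x + - a' * fst y" by (simp add: ab algebra_simps)
    also have "b * snd x * snd y + ?j = - b' * snd x + - b' * snd y" by (simp add: ab algebra_simps)
    also have "root_of_unity m (- a' * fst x + - a' * fst y) * root_of_unity k (- b' * snd x + - b' * snd y) = h x * h y"
      by (simp only: h_def root_of_unity_add ac_simps)
    moreover have "h (x \<otimes>\<^bsub>Q\<^esub> y) \<noteq> 0" by (simp add: h_def)
    ultimately show ?thesis by (simp add: eq_divide_eq)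
  qed
  have "bilinear_cocycle r = (\<lambda>(x, y)\<in>C2. h x * h y / h (x \<oplus>\<^bsub>Q\<^esub> y))"
    by (auto simp: bilinear_cocycle_def trivial h_add intro!: restrict_ext)
  moreover have "(\<lambda>(x, y)\<in>C2. character_part a b s t x y) = (\<lambda>(x, y)\<in>C2. h x * h y / h (x \<otimes>\<^bsub>Q\<^esub> y))"
    by (intro restrict_ext) (auto simp: char_eq)
  ultimately have "standard_factor_set (a, b, r, s, t) =
      (\<lambda>(x, y)\<in>C2. h x * h y / h (x \<oplus>\<^bsub>Q\<^esub> y), \<lambda>(x, y)\<in>C2. h x * h y / h (x \<otimes>\<^bsub>Q\<^esub> y))"
    by (simp add: standard_factor_set_def)
  moreover have "h \<in> carrier Q \<rightarrow> UNIV - {0}" "h \<zero>\<^bsub>Q\<^esub> = 1" by (simp_all add: h_def Q_simps)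
  ultimately show "standard_factor_set (a, b, r, s, t) \<in> B2b Q complex_units"
    unfolding B2b_complex_units by blast
qed

section \<open>Reduction of factor sets to standard ones\<close>

lemma bilinear_factor_set_standard:
  assumes "(bilinear_cocycle r, \<mu>) \<in> factor_sets Q complex_units"
  obtains a b s t where "(bilinear_cocycle r, \<mu>) = standard_factor_set (a, b, r, s, t)"
proof -
  have ext: "\<mu> \<in> C2 \<rightarrow>\<^sub>E UNIV - {0}"
    and cocycle: "\<And>x y z. \<lbrakk>x \<in> carrier Q; y \<in> carrier Q; z \<in> carrier Q\<rbrakk>
      \<Longrightarrow> \<mu> (y, z) * \<mu> (x, y \<otimes>\<^bsub>Q\<^esub> z) = \<mu> (x \<otimes>\<^bsub>Q\<^esub> y, z) * \<mu> (x, y)"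
    and add: "\<And>x y z. \<lbrakk>x \<in> carrier Q; y \<in> carrier Q; z \<in> carrier Q\<rbrakk>
      \<Longrightarrow> \<mu> (x, y \<oplus>\<^bsub>Q\<^esub> z) = \<mu> (x, y) * \<mu> (x, z)"
    using assms unfolding bilinear_factor_sets_iff by auto
  have nz: "\<mu> (x, y) \<noteq> 0" if "x \<in> carrier Q" "y \<in> carrier Q" for x y
    using ext that by (auto simp: PiE_iff)
  obtain a s where 1: "\<And>x i. \<lbrakk>x \<in> carrier Q; i \<in> {0..<int m}\<rbrakk>
    \<Longrightarrow> \<mu> (x, (i, 0)) = root_of_unity m (a * fst x * i) * root_of_unity g (s * snd x * i)"
    using crossed_character[OF nz add cocycle] by blast
  interpret swap: bicyclic_brace_pair k m d2 d1 g by (rule swapped)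
  have swap_mem: "prod.swap x \<in> carrier Q" if "x \<in> carrier swap.Q" for x
    using that by (auto simp: Q_simps swap.Q_simps)
  have swap_ops: "prod.swap (x \<oplus>\<^bsub>swap.Q\<^esub> y) = prod.swap x \<oplus>\<^bsub>Q\<^esub> prod.swap y"
    "prod.swap (x \<otimes>\<^bsub>swap.Q\<^esub> y) = prod.swap x \<otimes>\<^bsub>Q\<^esub> prod.swap y" for x y
    by (simp_all add: Q_simps swap.Q_simps)
  \<comment> \<open>The same function seen from the brace with exchanged factors; the statement
    about the first factor then yields the values at (0, y2), with the parameters \<open>b\<close>
    and \<open>t\<close>.\<close>
  define \<nu> where "\<nu> = (\<lambda>(x, y). \<mu> (prod.swap x, prod.swap y))"
  obtain b t where 2: "\<And>x i. \<lbrakk>x \<in> carrier swap.Q; i \<in> {0..<int k}\<rbrakk>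
    \<Longrightarrow> \<nu> (x, (i, 0)) = root_of_unity k (b * fst x * i) * root_of_unity g (t * snd x * i)"
  proof (rule swap.crossed_character[of \<nu>])
  qed (use nz add cocycle swap_mem in \<open>auto simp: \<nu>_def swap_ops\<close>)
  have "\<mu> (x, y) = character_part a b s t x y" if xy: "x \<in> carrier Q" "y \<in> carrier Q" for x y
  proof -
    have y: "(fst y, 0) \<in> carrier Q" "(0, snd y) \<in> carrier Q" "(fst y, 0) \<oplus>\<^bsub>Q\<^esub> (0, snd y) = y"
      "fst y \<in> {0..<int m}" "snd y \<in> {0..<int k}"
      using xy pos by (auto simp: Q_simps)
    have "prod.swap x \<in> carrier swap.Q" using xy by (auto simp: Q_simps swap.Q_simps)
    then have "\<mu> (x, (0, snd y)) = root_of_unity k (b * snd x * snd y) * root_of_unity g (t * fst x * snd y)"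
      using 2[of "prod.swap x" "snd y"] y by (simp add: \<nu>_def)
    then have "\<mu> (x, y) = (root_of_unity m (a * fst x * fst y) * root_of_unity g (s * snd x * fst y)) *
        (root_of_unity k (b * snd x * snd y) * root_of_unity g (t * fst x * snd y))"
      using add[OF xy(1) y(1,2)] 1[OF xy(1) y(4)] by (simp only: y(3))
    then show ?thesis by (simp only: character_part_def ac_simps)
  qed
  then have "\<mu> = (\<lambda>(x, y)\<in>C2. character_part a b s t x y)"
    using ext by (intro extensionalityI[of _ C2]) (auto simp: PiE_iff)
  then show thesis using that[of a b s t] by (simp add: standard_factor_set_def)
qed

text \<open>One function \<open>h\<close> must correct both components at once. It is chosen for the
  additive part alone; the quotient by its coboundary pair is again a factor set, now with bilinear
  additive part, so its multiplicative part is already under control.\<close>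

lemma factor_set_cohomologous_standard:
  assumes "z \<in> factor_sets Q complex_units"
  obtains D p where "D \<in> B2b Q complex_units" and "z = D \<otimes>\<^bsub>cochain_pairs Q\<^esub> standard_factor_set p"
proof -
  obtain \<alpha> \<mu> where z: "z = (\<alpha>, \<mu>)" by force
  define A where "A = integer_mod_group m \<times>\<times> integer_mod_group k"
  have carrier_A: "carrier A = carrier Q"
    using pos by (simp add: A_def carrier_integer_mod_group Q_simps)
  have mult_A: "x \<otimes>\<^bsub>A\<^esub> y = x \<oplus>\<^bsub>Q\<^esub> y" for x y
    by (cases x; cases y) (simp add: A_def Q_simps)
  have one_A: "\<one>\<^bsub>A\<^esub> = \<zero>\<^bsub>Q\<^esub>" by (simp add: A_def Q_simps)
  note z_mem = assms[unfolded z factor_sets_complex_units_iff[OF add_group circ_group]]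
  have "group A" by (simp add: A_def DirProd_group)
  then have cocycle: "complex_cocycle A \<alpha>"
    using z_mem
    by (intro complex_cocycle.intro complex_cocycle_axioms.intro)
      (auto simp: carrier_A mult_A one_A PiE_iff)
  obtain \<zeta> c where \<zeta>: "\<zeta> ^ m = 1" "\<zeta> ^ k = 1"
    and c: "c (0, 0) = 1" "\<And>x. x \<in> carrier Q \<Longrightarrow> c x \<noteq> 0"
    and c_mult: "\<And>x y. \<lbrakk>x \<in> carrier Q; y \<in> carrier Q\<rbrakk>
      \<Longrightarrow> c x * c y * \<alpha> (x, y) = \<zeta> ^ (nat (fst x) * nat (snd y)) * c (x \<oplus>\<^bsub>Q\<^esub> y)"
  proof -
    have "m > 1" "k > 1" using m k by simp_all
    from bilinear_representative[of m k \<alpha>, folded A_def, unfolded carrier_A mult_A, OF cocycle this]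
    show thesis using that by blast
  qed
  have "\<zeta> ^ g = 1" unfolding g by (rule power_gcd_eq_1[OF \<zeta>])
  then obtain r where r: "\<zeta> = root_of_unity g r"
    using obtain_root_of_unity pos(5) by blast
  \<comment> \<open>Solving \<open>c_mult\<close> for \<alpha> gives a power of \<zeta> times c(x +
    y) / (c(x) c(y)), which is the additive coboundary of 1/c.\<close>
  define h where "h x = inverse (c x)" for x
  define D where "D = (\<lambda>(x, y)\<in>C2. h x * h y / h (x \<oplus>\<^bsub>Q\<^esub> y), \<lambda>(x, y)\<in>C2. h x * h y / h (x \<otimes>\<^bsub>Q\<^esub> y))"
  have D: "D \<in> B2b Q complex_units"
    unfolding B2b_complex_units D_def using c by (auto simp: h_def Q_simps(2))
  interpret P: comm_group "cochain_pairs Q" by (rule comm_group_cochain_pairs)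
  note subgroup_Z = subgroup_factor_sets[OF add_group circ_group]
  have D_mem: "D \<in> factor_sets Q complex_units"
    using D B2b_subset_factor_sets by blast
  then have D_carrier: "D \<in> carrier (cochain_pairs Q)" and z_carrier: "z \<in> carrier (cochain_pairs Q)"
    using assms subgroup.mem_carrier[OF subgroup_Z] by blast+
  define Y where "Y = inv\<^bsub>cochain_pairs Q\<^esub> D \<otimes>\<^bsub>cochain_pairs Q\<^esub> z"
  have Y_mem: "Y \<in> factor_sets Q complex_units"
    unfolding Y_def
    by (intro subgroup.m_closed[OF subgroup_Z] subgroup.m_inv_closed[OF subgroup_Z] D_mem assms)
  have z_eq: "z = D \<otimes>\<^bsub>cochain_pairs Q\<^esub> Y"
    using D_carrier z_carrier
    by (simp only: Y_def P.m_assoc[symmetric] P.inv_closed P.r_inv P.l_one)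
  obtain \<alpha>' \<mu>' where Y: "Y = (\<alpha>', \<mu>')" by force
  have "\<alpha>' (x, y) = bilinear_cocycle r (x, y)" if xy: "x \<in> carrier Q" "y \<in> carrier Q" for x y
  proof -
    have nz: "c x \<noteq> 0" "c y \<noteq> 0" "c (x \<oplus>\<^bsub>Q\<^esub> y) \<noteq> 0" using c(2) xy add_closed by blast+
    have "\<alpha> = (\<lambda>p\<in>C2. (\<lambda>(x, y)\<in>C2. h x * h y / h (x \<oplus>\<^bsub>Q\<^esub> y)) p * \<alpha>' p)"
      using z_eq unfolding z Y D_def cochain_pairs_simps by simp
    from fun_cong[OF this, of "(x, y)"]
    have "\<alpha> (x, y) = inverse (c x) * inverse (c y) / inverse (c (x \<oplus>\<^bsub>Q\<^esub> y)) * \<alpha>' (x, y)"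
      using xy by (simp add: h_def)
    moreover have "p * q * (inverse p * inverse q / inverse u * v) = u * v"
      if "p \<noteq> 0" "q \<noteq> 0" for p q u v :: complex
      using that by (simp add: field_simps)
    ultimately have "c x * c y * \<alpha> (x, y) = c (x \<oplus>\<^bsub>Q\<^esub> y) * \<alpha>' (x, y)"
      using nz by simp
    then have "\<alpha>' (x, y) = \<zeta> ^ (nat (fst x) * nat (snd y))"
      using c_mult[OF xy] nz(3) by simp
    also have "\<dots> = root_of_unity g (r * fst x * snd y)"
      using xy by (auto simp: r root_of_unity_power Q_simps ac_simps)
    finally show ?thesis using xy by (simp add: bilinear_cocycle)
  qed
  moreover have "\<alpha>' \<in> extensional C2"
    using Y_mem unfolding Y factor_sets_complex_units_iff[OF add_group circ_group] by (auto simp: PiE_iff)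
  ultimately have "\<alpha>' = bilinear_cocycle r"
    by (intro extensionalityI[of _ C2]) (auto simp: bilinear_cocycle_def)
  then obtain a b s t where "Y = standard_factor_set (a, b, r, s, t)"
    using Y_mem bilinear_factor_set_standard unfolding Y by metis
  then show thesis using that D z_eq by blast
qed

text \<open>Z^5 maps onto both groups, by cosets of standard factor sets and by reduction of
  coordinates. Comparing the two kernels replaces any map out of the quotient, for which
  well-definedness would have to be checked.\<close>

lemma schur_multiplier_iso:
  "schur_multiplier Q \<cong>
    integer_mod_group d1 \<times>\<times> integer_mod_group d2 \<times>\<times>
    integer_mod_group g \<times>\<times> integer_mod_group g \<times>\<times> integer_mod_group g"
proof -
  define P where "P = integer_group \<times>\<times> integer_group \<times>\<times> integer_group \<times>\<times> integer_group \<times>\<times> integer_group"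
  define Z where "Z = Z2b Q complex_units"
  define B where "B = B2b Q complex_units"
  define M where "M = integer_mod_group d1 \<times>\<times> integer_mod_group d2 \<times>\<times>
    integer_mod_group g \<times>\<times> integer_mod_group g \<times>\<times> integer_mod_group g"
  interpret C: comm_group "cochain_pairs Q" by (rule comm_group_cochain_pairs)
  note subgroup_Z = subgroup_factor_sets[OF add_group circ_group]
  have Z: "Z = (cochain_pairs Q)\<lparr>carrier := factor_sets Q complex_units\<rparr>"
    by (simp add: Z_def Z2b_complex_units)
  have carrier_Z: "carrier Z = factor_sets Q complex_units" by (simp add: Z)
  have mult_Z: "x \<otimes>\<^bsub>Z\<^esub> y = x \<otimes>\<^bsub>cochain_pairs Q\<^esub> y" for x y by (simp add: Z)
  have "comm_group Z"
    unfolding Z using subgroup.subgroup_is_group[OF subgroup_Z C.group_axioms]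
    by (rule group.group_comm_groupI)
      (use C.m_comm subgroup.mem_carrier[OF subgroup_Z] in auto)
  then interpret Z: comm_group Z .
  have subgroup_B: "subgroup B Z"
    unfolding B_def Z by (rule C.subgroup_incl[OF subgroup_B2b subgroup_Z B2b_subset_factor_sets])
  then interpret B: normal B Z by (rule Z.subgroup_imp_normal)
  have H: "schur_multiplier Q = Z Mod B"
    by (simp add: schur_multiplier_def H2b_def Z_def B_def)
  have std_mem: "standard_factor_set p \<in> carrier Z" for p
    by (simp add: Z standard_factor_set_mem)
  define \<Phi> where "\<Phi> p = B #>\<^bsub>Z\<^esub> standard_factor_set p" for p
  have group_P: "group P" by (simp add: P_def DirProd_group)
  have "standard_factor_set \<in> hom P Z"
    by (rule homI) (auto simp: std_mem P_def mult_Z standard_factor_set_add)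
  from hom_compose[OF this B.r_coset_hom_Mod] have "\<Phi> \<in> hom P (Z Mod B)"
    by (simp add: \<Phi>_def[abs_def] comp_def)
  then have hom_\<Phi>: "group_hom P (Z Mod B) \<Phi>"
    by (simp add: group_hom_def group_hom_axioms_def group_P B.factorgroup_is_group)
  define \<Psi> where "\<Psi> = (\<lambda>(a, b, r, s, t). (a mod int d1, b mod int d2, r mod int g, s mod int g, t mod int g))"
  have "group M" by (simp add: M_def DirProd_group)
  moreover have "\<Psi> \<in> hom P M"
    using pos by (intro homI) (auto simp: \<Psi>_def P_def M_def carrier_integer_mod_group mod_simps)
  ultimately have hom_\<Psi>: "group_hom P M \<Psi>"
    by (simp add: group_hom_def group_hom_axioms_def group_P)
  have "\<Phi> ` carrier P = carrier (Z Mod B)"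
  proof
    show "\<Phi> ` carrier P \<subseteq> carrier (Z Mod B)"
      using group_hom.hom_closed[OF hom_\<Phi>] by blast
    show "carrier (Z Mod B) \<subseteq> \<Phi> ` carrier P"
    proof
      fix Y assume "Y \<in> carrier (Z Mod B)"
      then obtain z where z: "z \<in> carrier Z" "Y = B #>\<^bsub>Z\<^esub> z"
        by (auto simp: FactGroup_def RCOSETS_def)
      then obtain D p where "D \<in> B" "z = D \<otimes>\<^bsub>Z\<^esub> standard_factor_set p"
        unfolding mult_Z B_def using factor_set_cohomologous_standard[of z] carrier_Z by metis
      \<comment> \<open>The coboundary \<open>D\<close> is absorbed by the coset.\<close>
      then have "Y = B #>\<^bsub>Z\<^esub> standard_factor_set p"
        using z Z.coset_mult_assoc[of B D "standard_factor_set p"] Z.coset_join2[OF _ subgroup_B, of D]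
          B.subset std_mem B.mem_carrier by simp
      then show "Y \<in> \<Phi> ` carrier P" by (auto simp: \<Phi>_def P_def)
    qed
  qed
  moreover have "\<Psi> ` carrier P = carrier M"
  proof -
    have "p \<in> \<Psi> ` carrier P" if "p \<in> carrier M" for p
    proof (rule image_eqI)
      \<comment> \<open>Carriers consist of reduced residues, so a tuple of residues is its own
        preimage.\<close>
      show "p = \<Psi> p"
        using that pos by (auto simp: \<Psi>_def M_def carrier_integer_mod_group)
    qed (simp add: P_def)
    then show ?thesis using group_hom.hom_closed[OF hom_\<Psi>] by blast
  qed
  \<comment> \<open>Either kernel consists of the parameters whose standard factor set is a
    coboundary; for the reduction map this is the divisibility criterion.\<close>
  moreover have "kernel P (Z Mod B) \<Phi> = kernel P M \<Psi>"
  proof -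
    have "\<Phi> p = \<one>\<^bsub>Z Mod B\<^esub> \<longleftrightarrow> standard_factor_set p \<in> B" for p
    proof
      assume "\<Phi> p = \<one>\<^bsub>Z Mod B\<^esub>"
      then have "B #>\<^bsub>Z\<^esub> standard_factor_set p = B" by (simp add: \<Phi>_def)
      then show "standard_factor_set p \<in> B"
        by (rule Z.coset_join1[OF _ std_mem subgroup_B])
    next
      assume "standard_factor_set p \<in> B"
      then have "B #>\<^bsub>Z\<^esub> standard_factor_set p = B"
        by (rule Z.coset_join2[OF std_mem subgroup_B])
      then show "\<Phi> p = \<one>\<^bsub>Z Mod B\<^esub>" by (simp add: \<Phi>_def)
    qed
    moreover have "\<Psi> p = \<one>\<^bsub>M\<^esub> \<longleftrightarrow> standard_factor_set p \<in> B" for p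
      by (cases p rule: prod_cases5)
        (simp add: \<Psi>_def M_def B_def standard_factor_set_mem_B2b_iff dvd_eq_mod_eq_0)
    ultimately show ?thesis by (simp add: kernel_def)
  qed
  ultimately show ?thesis
    using iso_if_surj_same_kernel[OF hom_\<Phi> hom_\<Psi>] by (simp add: H M_def)
qed

end

theorem theorem2p24:
  fixes m k d\<^sub>1 d\<^sub>2 g :: nat
  assumes "m \<ge> 2" and "d\<^sub>1 dvd m" and "\<And>p. Factorial_Ring.prime p \<Longrightarrow> p dvd m \<Longrightarrow> p dvd d\<^sub>1"
    and "k \<ge> 2" and "d\<^sub>2 dvd k" and "\<And>p. Factorial_Ring.prime p \<Longrightarrow> p dvd k \<Longrightarrow> p dvd d\<^sub>2"
    and "bicyclic (C_brace m d\<^sub>1)" and "bicyclic (C_brace k d\<^sub>2)"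
    and "g = gcd m k" and "g = gcd d\<^sub>1 d\<^sub>2"
  shows "schur_multiplier (RDirProd (C_brace m d\<^sub>1) (C_brace k d\<^sub>2)) \<cong>
    integer_mod_group d\<^sub>1 \<times>\<times> integer_mod_group d\<^sub>2 \<times>\<times>
    integer_mod_group g \<times>\<times> integer_mod_group g \<times>\<times> integer_mod_group g"
  by (rule bicyclic_brace_pair.schur_multiplier_iso, rule bicyclic_brace_pair.intro) (fact assms)+

end
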